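(* Let $1\le p<\infty$ and $1\le r\le p^*$. For a sequence $(x_n)$ in a Banach space $X$ the following statements are equivalent: (a) $(x_n)$ is $(p,r)$-null; (b) $(x_n)$ is null and relatively $(p,r)$-compact; (c) $(x_n)$ is null and $\mathcal N_{(p,1,r^* )}$-compact; (d) $(x_n)$ is null and $\mathcal K_{(p,r)}$-compact; (e) $(x_n)$ is $\mathcal N_{(p,1,r^* )}$-null; (f) $(x_n)$ is $\mathcal K_{(p,r)}$-null; (g) $(x_n)$ is uniformly $(p,r)$-null.
   Context: Banach spaces are over a fixed field, $\mathbb R$ or $\mathbb C$. $p^*,r^*$ are conjugate indices ($1/p+1/p^*=1$, $1/\infty=0$). Convention: $\ell_\infty$ denotes $c_0$. $B_Z$ is the closed unit ball of $Z$; a null sequence is one converging to $0$ in norm. $\ell_p(X)$ is the Banach space of absolutely $p$-summable sequences in $X$ with its norm $\|\cdot\|_p$. The $(p,r)$-convex hull of $(x_k)\in\ell_p(X)$ is $(p,r)\text{-conv}(x_k)=\{\sum_{k=1}^\infty a_kx_k:(a_k)\in B_{\ell_r}\}$. A subset $K\subset X$ is relatively $(p,r)$-compact if $K\subset(p,r)\text{-conv}(z_k)$ for some $(z_k)\in\ell_p(X)$. $(x_n)$ is $(p,r)$-null if for every $\varepsilon>0$ there exist $(z_k)\in\varepsilon B_{\ell_p(X)}$ and $N\in\mathbb N$ such that $x_n\in(p,r)\text{-conv}(z_k)$ for all $n\ge N$. $(x_n)$ is uniformly $(p,r)$-null if there exists $(z_k)\in B_{\ell_p(X)}$ such that for every $\varepsilon>0$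 there exists $N\in\mathbb N$ with $x_n\in\varepsilon\,(p,r)\text{-conv}(z_k)$ for all $n\ge N$. $\mathcal K_{(p,r)}$ is the operator ideal of $(p,r)$-compact operators: linear $T:Y\to X$ between Banach spaces such that $T(B_Y)$ is relatively $(p,r)$-compact in $X$. $\mathcal N_{(p,1,r^* )}$ is the operator ideal of $(p,1,r^* )$-nuclear operators (in the sense of Pietsch): operators $T:Y\to X$ of the form $Ty=\sum_{n=1}^\infty\sigma_n a_n(y)x_n$ ($y\in Y$), where $(\sigma_n)\in\ell_p$, $(x_n)$ is a bounded sequence in $X$, and $(a_n)$ is a weakly $r$-summable sequence in $Y^*$ (for $r=\infty$: a bounded sequence in $Y^*$). Let $\mathcal A$ be an operator ideal. A sequence $(x_n)$ in $X$ is $\mathcal A$-null if there exist a Banach space $Y$, a (norm) null sequence $(y_n)$ in $Y$ and $T\in\mathcal A(Y,X)$ such that $x_n=Ty_n$ for all $n$. A subset $K\subset X$ is $\mathcal A$-compact if $K\subset T(F)$ for some Banach space $Y$, some relatively compact $F\subset Y$ and some $T\in\mathcal A(Y,X)$. A sequence is called relatively $(p,r)$-compact, or $\mathcal A$-compact, if the set of its terms is. *)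

theory Defs
  imports "HOL-Analysis.Analysis" "HOL-Algebra.Module"
begin

section \<open>Banach spaces over the real or complex field\<close>

text \<open>
  The scalar field is a type of class \<open>{real_normed_field, euclidean_space}\<close>. Both
  \<open>real\<close> and \<open>complex\<close> are instances, and up to isometric isomorphism there is no
  other one, since the norm of a \<open>real_normed_field\<close> is multiplicative.

  The space containing the sequence under consideration is a type of class \<open>banach\<close> together
  with a scalar multiplication over that field. The auxiliary Banach spaces are quantified
  existentially inside definitions and therefore cannot be types; they are records with an
  explicit carrier, which may be a proper subset of its type and has its own operations.
\<close>

locale banach_over = vector_space smul
  for smul :: "'k::{real_normed_field,euclidean_space} \<Rightarrow> 'x::banach \<Rightarrow> 'x" +
  assumes smul_of_real: "smul (of_real t) x = t *\<^sub>R x"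
    and norm_smul: "norm (smul c x) = norm c * norm x"

definition scalar_ring :: "'k::field ring" where
  "scalar_ring = \<lparr>carrier = UNIV, monoid.mult = (*), one = 1, zero = 0, add = (+)\<rparr>"

text \<open>The fields \<open>mult\<close> and \<open>one\<close>, inherited from the ring record, play no role.\<close>

record ('k, 'v) nspace = "('k, 'v) module" +
  vnorm :: "'v \<Rightarrow> real"

text \<open>\<^locale>\<open>Metric_space\<close> needs a nonnegative, symmetric distance also off the carrier.\<close>

definition vdist :: "('k, 'v) nspace \<Rightarrow> 'v \<Rightarrow> 'v \<Rightarrow> real" where
  "vdist Y u v = (if u \<in> carrier Y \<and> v \<in> carrier Y then vnorm Y (u \<ominus>\<^bsub>Y\<^esub> v) else 0)"

locale carrier_normed_space = Module.module scalar_ring Y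
  for Y :: "('k::{real_normed_field,euclidean_space}, 'v) nspace" (structure) +
  assumes vnorm_eq_0: "u \<in> carrier Y \<Longrightarrow> vnorm Y u = 0 \<longleftrightarrow> u = \<zero>"
    and vnorm_smult: "u \<in> carrier Y \<Longrightarrow> vnorm Y (c \<odot> u) = norm c * vnorm Y u"
    and vnorm_add: "u \<in> carrier Y \<Longrightarrow> v \<in> carrier Y \<Longrightarrow> vnorm Y (u \<oplus> v) \<le> vnorm Y u + vnorm Y v"
begin

lemma vnorm_uminus:
  assumes "u \<in> carrier Y" shows "vnorm Y (\<ominus> u) = vnorm Y u"
proof -
  have "\<ominus> u = (- 1) \<odot> u"
    using smult_l_minus[of 1 u] smult_one[OF assms] assms R.minus_equality[of "- 1" 1]
    by (simp add: scalar_ring_def)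
  then show ?thesis using vnorm_smult[OF assms, of "- 1"] by simp
qed

lemma vnorm_nonneg:
  assumes "u \<in> carrier Y" shows "0 \<le> vnorm Y u"
  using vnorm_add[OF assms M.a_inv_closed[OF assms]] vnorm_uminus[OF assms]
    vnorm_eq_0[OF M.zero_closed] assms
  by (simp add: M.r_neg)

lemma Metric_space_vdist: "Metric_space (carrier Y) (vdist Y)"
proof
  show "0 \<le> vdist Y u v" for u v
    by (simp add: vdist_def vnorm_nonneg)
  show "vdist Y u v = vdist Y v u" for u v
    using vnorm_uminus[of "u \<ominus> v"]
    by (auto simp: vdist_def M.minus_eq M.minus_add M.a_comm M.minus_minus)
  show "vdist Y u v = 0 \<longleftrightarrow> u = v" if "u \<in> carrier Y" "v \<in> carrier Y" for u v
    using that vnorm_eq_0[of "u \<ominus> v"] M.minus_equality[of u "\<ominus> v"]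
    by (auto simp: vdist_def M.minus_eq M.r_neg M.minus_minus)
  show "vdist Y u w \<le> vdist Y u v + vdist Y v w"
    if "u \<in> carrier Y" "v \<in> carrier Y" "w \<in> carrier Y" for u v w
  proof -
    have "u \<ominus> w = (u \<ominus> v) \<oplus> (v \<ominus> w)"
      using that by (simp add: M.minus_eq M.a_assoc) (metis M.a_inv_closed M.add.m_closed M.l_neg M.l_zero M.a_assoc)
    then show ?thesis
      using that vnorm_add[of "u \<ominus> v" "v \<ominus> w"] by (simp add: vdist_def)
  qed
qed

end

locale carrier_banach_space = carrier_normed_space +
  assumes complete: "Metric_space.mcomplete (carrier Y) (vdist Y)"

definition relatively_compact_in :: "('k, 'v) nspace \<Rightarrow> 'v set \<Rightarrow> bool" where
  "relatively_compact_in Y F \<longleftrightarrow> F \<subseteq> carrier Y \<and>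
     (let \<tau> = Metric_space.mtopology (carrier Y) (vdist Y) in compactin \<tau> (\<tau> closure_of F))"

definition null_in :: "('k, 'v) nspace \<Rightarrow> (nat \<Rightarrow> 'v) \<Rightarrow> bool" where
  "null_in Y y \<longleftrightarrow> range y \<subseteq> carrier Y \<and> (\<lambda>n. vnorm Y (y n)) \<longlonglongrightarrow> 0"

definition unit_ball :: "('k, 'v) nspace \<Rightarrow> 'v set" where
  "unit_ball Y = {u \<in> carrier Y. vnorm Y u \<le> 1}"


section \<open>Operators, functionals, dual space\<close>

definition linear_op ::
    "('k \<Rightarrow> 'x \<Rightarrow> 'x::real_normed_vector) \<Rightarrow> ('k, 'v) nspace \<Rightarrow> ('v \<Rightarrow> 'x) \<Rightarrow> bool" where
  "linear_op smul Y T \<longleftrightarrow>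
     (\<forall>u\<in>carrier Y. \<forall>v\<in>carrier Y. T (u \<oplus>\<^bsub>Y\<^esub> v) = T u + T v) \<and>
     (\<forall>c. \<forall>u\<in>carrier Y. T (c \<odot>\<^bsub>Y\<^esub> u) = smul c (T u))"

definition bounded_op ::
    "('k \<Rightarrow> 'x \<Rightarrow> 'x::real_normed_vector) \<Rightarrow> ('k, 'v) nspace \<Rightarrow> ('v \<Rightarrow> 'x) \<Rightarrow> bool" where
  "bounded_op smul Y T \<longleftrightarrow> linear_op smul Y T \<and>
     (\<exists>C. \<forall>u\<in>carrier Y. norm (T u) \<le> C * vnorm Y u)"

text \<open>
  Functionals are normalised to vanish off the carrier, so that a functional is determined by its
  values on the carrier and the operations of the dual are pointwise.
\<close>

definition dual :: "('k::real_normed_field, 'v) nspace \<Rightarrow> ('k, 'v \<Rightarrow> 'k) nspace" where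
  "dual Y =
     \<lparr>carrier = {f. bounded_op (*) Y f \<and> (\<forall>u. u \<notin> carrier Y \<longrightarrow> f u = 0)},
      monoid.mult = undefined, one = undefined,
      zero = (\<lambda>u. 0), add = (\<lambda>f g u. f u + g u), smult = (\<lambda>c f u. c * f u),
      vnorm = (\<lambda>f. SUP u\<in>unit_ball Y. norm (f u))\<rparr>"


section \<open>Sequence spaces\<close>

definition conj_index :: "ereal \<Rightarrow> ereal" where
  "conj_index p = inverse (1 - inverse p)"

lemma conj_index:
  assumes "1 \<le> p" shows "1 / p + 1 / conj_index p = 1"
proof (cases p)
  case (real t)
  then show ?thesis using assms
    by (cases "t = 1") (auto simp: conj_index_def one_ereal_def divide_ereal_def field_simps)
qed (use assms in \<open>auto simp: conj_index_def divide_ereal_def\<close>)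

text \<open>
  Both scalar sequences and sequences in a Banach space are covered; the space for the index
  \<open>\<infinity>\<close> is \<open>c\<^sub>0\<close>.
\<close>

definition lp :: "ereal \<Rightarrow> (nat \<Rightarrow> 'a::real_normed_vector) set" where
  "lp q = (if q = \<infinity> then {a. a \<longlonglongrightarrow> 0}
           else {a. summable (\<lambda>k. norm (a k) powr real_of_ereal q)})"

definition lp_norm :: "ereal \<Rightarrow> (nat \<Rightarrow> 'a::real_normed_vector) \<Rightarrow> real" where
  "lp_norm q a = (if q = \<infinity> then SUP k. norm (a k)
     else (\<Sum>k. norm (a k) powr real_of_ereal q) powr (1 / real_of_ereal q))"

definition lp_ball :: "ereal \<Rightarrow> real \<Rightarrow> (nat \<Rightarrow> 'a::real_normed_vector) set" where
  "lp_ball q \<epsilon> = {a \<in> lp q. lp_norm q a \<le> \<epsilon>}"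

definition weakly_summable ::
    "('k::real_normed_field, 'v) nspace \<Rightarrow> ereal \<Rightarrow> (nat \<Rightarrow> 'v) \<Rightarrow> bool" where
  "weakly_summable Z r a \<longleftrightarrow> range a \<subseteq> carrier Z \<and>
     (if r = \<infinity> then \<exists>C. \<forall>n. vnorm Z (a n) \<le> C
      else \<forall>\<phi>\<in>carrier (dual Z). (\<lambda>n. \<phi> (a n)) \<in> lp r)"


section \<open>(p,r)-null sequences, (p,r)-compact sets and the two operator ideals\<close>

definition pr_conv ::
    "('k::real_normed_field \<Rightarrow> 'x \<Rightarrow> 'x::real_normed_vector) \<Rightarrow> ereal \<Rightarrow> (nat \<Rightarrow> 'x) \<Rightarrow> 'x set" where
  "pr_conv smul r z = {x. \<exists>a\<in>lp_ball r 1. (\<lambda>k. smul (a k) (z k)) sums x}"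

definition rel_pr_compact ::
    "('k::real_normed_field \<Rightarrow> 'x \<Rightarrow> 'x::real_normed_vector) \<Rightarrow> ereal \<Rightarrow> ereal \<Rightarrow> 'x set \<Rightarrow> bool" where
  "rel_pr_compact smul p r K \<longleftrightarrow> (\<exists>z\<in>lp p. K \<subseteq> pr_conv smul r z)"

definition pr_null ::
    "('k::real_normed_field \<Rightarrow> 'x \<Rightarrow> 'x::real_normed_vector) \<Rightarrow> ereal \<Rightarrow> ereal \<Rightarrow> (nat \<Rightarrow> 'x) \<Rightarrow> bool" where
  "pr_null smul p r x \<longleftrightarrow>
     (\<forall>\<epsilon>>0. \<exists>z\<in>lp_ball p \<epsilon>. \<exists>N. \<forall>n\<ge>N. x n \<in> pr_conv smul r z)"

definition uniformly_pr_null ::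
    "('k::real_normed_field \<Rightarrow> 'x \<Rightarrow> 'x::real_normed_vector) \<Rightarrow> ereal \<Rightarrow> ereal \<Rightarrow> (nat \<Rightarrow> 'x) \<Rightarrow> bool" where
  "uniformly_pr_null smul p r x \<longleftrightarrow>
     (\<exists>z\<in>lp_ball p 1. \<forall>\<epsilon>>0. \<exists>N. \<forall>n\<ge>N. x n \<in> (\<lambda>v. \<epsilon> *\<^sub>R v) ` pr_conv smul r z)"

text \<open>
  The operators of an ideal into the fixed space on \<open>'x\<close> are given by a predicate on pairs of a
  domain and a map. The type \<open>'y\<close> of the points of the domains acts as a universe: the
  existential quantifiers over Banach spaces below range over all Banach spaces whose carrier is a
  set of elements of \<open>'y\<close>. A statement for every \<open>'y\<close> into which
  \<open>nat \<Rightarrow> 'k\<close> embeds thus covers, up to isometric isomorphism, Banach spaces of every size.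
\<close>

type_synonym ('k, 'y, 'x) op_ideal = "('k, 'y) nspace \<Rightarrow> ('y \<Rightarrow> 'x) \<Rightarrow> bool"

definition pr_compact_op ::
    "('k::real_normed_field \<Rightarrow> 'x \<Rightarrow> 'x::real_normed_vector) \<Rightarrow> ereal \<Rightarrow> ereal \<Rightarrow> ('k, 'y, 'x) op_ideal" where
  "pr_compact_op smul p r Y T \<longleftrightarrow>
     linear_op smul Y T \<and> rel_pr_compact smul p r (T ` unit_ball Y)"

text \<open>The ideal of \<open>(p,1,r\<^sup>*)\<close>-nuclear operators, with \<open>r\<close> instead of \<open>r\<^sup>*\<close> as a parameter.\<close>

definition p1rstar_nuclear_op ::
    "('k::real_normed_field \<Rightarrow> 'x \<Rightarrow> 'x::real_normed_vector) \<Rightarrow> ereal \<Rightarrow> ereal \<Rightarrow> ('k, 'y, 'x) op_ideal" where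
  "p1rstar_nuclear_op smul p r Y T \<longleftrightarrow> bounded_op smul Y T \<and>
     (\<exists>\<sigma>\<in>lp p. \<exists>w a. bounded (range w) \<and> weakly_summable (dual Y) r a \<and>
        (\<forall>y\<in>carrier Y. (\<lambda>n. smul (\<sigma> n * a n y) (w n)) sums T y))"

definition ideal_null :: "('k::{real_normed_field,euclidean_space}, 'y, 'x) op_ideal \<Rightarrow> (nat \<Rightarrow> 'x) \<Rightarrow> bool" where
  "ideal_null A x \<longleftrightarrow>
     (\<exists>Y y T. carrier_banach_space Y \<and> null_in Y y \<and> A Y T \<and> (\<forall>n. x n = T (y n)))"

definition ideal_compact :: "('k::{real_normed_field,euclidean_space}, 'y, 'x) op_ideal \<Rightarrow> 'x set \<Rightarrow> bool" where
  "ideal_compact A K \<longleftrightarrow>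
     (\<exists>Y F T. carrier_banach_space Y \<and> relatively_compact_in Y F \<and> A Y T \<and> K \<subseteq> T ` F)"

end

theory Submission
  imports Defs "HOL-Complex_Analysis.Great_Picard"
begin

text \<open>
  The core is that a null sequence in the hull of some \<open>z\<close> in \<open>lp p\<close> can be represented, in the hull
  of another such sequence \<open>w\<close>, by coefficients that tend to 0 in \<open>lp r\<close>. Write \<open>z k = \<tau> k * w k\<close>
  with \<open>\<tau>\<close> null and \<open>w\<close> still in \<open>lp p\<close>. Multiplication by \<open>\<tau>\<close> is a compact operator on \<open>lp r\<close>,
  and on the resulting compact set of coefficients the map onto the represented vectors is, modulo
  its kernel, a homeomorphism onto its image; so null vectors have null coefficients. Such a
  representation makes the sequence uniformly null, and it exhibits the sequence as the image of a
  null sequence of coefficients under a nuclear operator. Conversely, nuclear operators are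
  (p,r)-compact: the uniform boundedness principle makes the coefficients of the image of the unit
  ball bounded, and the same factorization turns them into elements of \<open>lp r\<close>.
\<close>

text \<open>The obstacle is that coefficients are not unique: a vector of small norm may be given
  with coefficients of norm 1, which differ from small ones by a sequence representing 0. A given
  choice of coefficients therefore has to be corrected before it can be small. The condition
  \<open>r \<le> conj_index p\<close> enters through Hoelder's inequality, which makes the series of
  the hulls absolutely convergent; \<open>r = \<infinity>\<close> can occur only together with
  \<open>p = 1\<close>. The convention that the index \<infinity> means c_0 causes a second
  difficulty: the unit ball of c_0 is not closed under pointwise limits, so compactness fails there.
  The arguments therefore run with bounds on all finite sections, which at \<infinity> describe
  bounded sequences, and multiplication by null weights leads back to c_0. Likewise the domain of
  the constructed nuclear operator is, at \<infinity>, the space of all bounded sequences: its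
  completeness follows from pointwise limits without keeping track of null limits.\<close>

section \<open>Convexity of powers and Minkowski's inequality for finite sums\<close>

lemma powr_convex_nonneg:
  fixes q u v x y :: real
  assumes q: "1 \<le> q" and "0 \<le> x" "0 \<le> y" "0 \<le> u" "0 \<le> v" "u + v = 1"
  shows "(u * x + v * y) powr q \<le> u * x powr q + v * y powr q"
proof -
  \<comment> \<open>Serves the cases with a zero argument, where convexity reduces to this bound for
    one of the weights.\<close>
  have le_self: "t powr q \<le> t" if "0 \<le> t" "t \<le> 1" for t :: real
    using powr_le_one_le[of t q] that q by (cases "t = 0") auto
  have u: "u = 1 - v" using \<open>u + v = 1\<close> by simp
  consider "x = 0" | "y = 0" | "0 < x" "0 < y" using assms by fastforce
  then show ?thesis
  proof cases
    case 1
    then show ?thesis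
      using assms le_self[of v] by (simp add: powr_mult mult_right_mono)
  next
    case 2
    then show ?thesis
      using assms le_self[of u] by (simp add: powr_mult mult_right_mono)
  next
    case 3
    then show ?thesis
      using convex_onD[OF powr_convex[OF q], of v x y] assms(4,5) u by simp
  qed
qed

text \<open>By homogeneity this is convexity of the power: with norms A, B and S = A + B, the sum
  divided by S is a convex combination of the normalised sequences with weights A / S and B / S. A
  sequence of norm 0 cannot be normalised and is treated separately.\<close>

lemma minkowski_sum:
  fixes a b :: "'i \<Rightarrow> 'a::real_normed_vector"
  assumes q: "1 \<le> q" and "finite I"
  shows "(\<Sum>i\<in>I. norm (a i + b i) powr q) powr (1 / q)
    \<le> (\<Sum>i\<in>I. norm (a i) powr q) powr (1 / q) + (\<Sum>i\<in>I. norm (b i) powr q) powr (1 / q)"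
    (is "?L \<le> ?A + ?B")
proof -
  have zero: "c i = 0" if "(\<Sum>i\<in>I. norm (c i) powr q) powr (1 / q) = 0" "i \<in> I"
    for c :: "'i \<Rightarrow> 'a" and i
    using that sum_nonneg_eq_0_iff[OF \<open>finite I\<close>, of "\<lambda>i. norm (c i) powr q"] by auto
  consider "?A = 0" | "?B = 0" | "0 < ?A" "0 < ?B" by (metis powr_ge_zero order_le_less)
  then show ?thesis
  proof cases
    case 1
    then have "?L = ?B" using zero[of a] by simp
    then show ?thesis using 1 by linarith
  next
    case 2
    then have "?L = ?A" using zero[of b] by simp
    then show ?thesis using 2 by linarith
  next
    case 3
    define A B S where "A = ?A" and "B = ?B" and "S = A + B"
    have pos: "0 < A" "0 < B" "0 < S" using 3 by (auto simp: A_def B_def S_def intro: add_pos_pos)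
    have A: "A powr q = (\<Sum>i\<in>I. norm (a i) powr q)" and B: "B powr q = (\<Sum>i\<in>I. norm (b i) powr q)"
      using q by (simp_all add: A_def B_def powr_powr sum_nonneg)
    have "norm (a i + b i) powr q
      \<le> S powr q * (A / S * (norm (a i) powr q / A powr q) + B / S * (norm (b i) powr q / B powr q))" for i
    proof -
      have "norm (a i + b i) powr q \<le> (norm (a i) + norm (b i)) powr q"
        using q by (intro powr_mono2 norm_triangle_ineq) auto
      also have "norm (a i) + norm (b i) = S * (A / S * (norm (a i) / A) + B / S * (norm (b i) / B))"
        using pos by (simp add: field_simps)
      also have "\<dots> powr q = S powr q * (A / S * (norm (a i) / A) + B / S * (norm (b i) / B)) powr q"
        using pos by (subst powr_mult) auto
      also have "\<dots> \<le> S powr q * (A / S * (norm (a i) / A) powr q + B / S * (norm (b i) / B) powr q)"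
        using pos q
        by (intro mult_left_mono powr_convex_nonneg) (auto simp: S_def add_divide_distrib[symmetric])
      finally show ?thesis using pos by (simp add: powr_divide)
    qed
    then have "(\<Sum>i\<in>I. norm (a i + b i) powr q)
      \<le> (\<Sum>i\<in>I. S powr q * (A / S * (norm (a i) powr q / A powr q) + B / S * (norm (b i) powr q / B powr q)))"
      by (intro sum_mono)
    also have "\<dots> = S powr q * (A / S * ((\<Sum>i\<in>I. norm (a i) powr q) / A powr q)
        + B / S * ((\<Sum>i\<in>I. norm (b i) powr q) / B powr q))"
      by (simp only: sum_distrib_left sum.distrib sum_divide_distrib distrib_left)
    also have "\<dots> = S powr q * (A / S + B / S)"
      unfolding A[symmetric] B[symmetric] using pos by simp
    also have "A / S + B / S = 1"
      using pos unfolding S_def by (simp add: add_divide_distrib[symmetric])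
    finally have "?L \<le> (S powr q * 1) powr (1 / q)"
      using q by (intro powr_mono2 sum_nonneg) auto
    then have "?L \<le> S" using q pos by (simp add: powr_powr)
    then show ?thesis by (simp add: A_def B_def S_def)
  qed
qed

section \<open>Finite sections of sequence norms\<close>

text \<open>In both cases the norm is the supremum over \<^term>\<open>N\<close>. Unlike the norm, each section is
  continuous for pointwise convergence; at \<^term>\<open>r = \<infinity>\<close> a single entry suffices for this.\<close>

definition section_norm :: "ereal \<Rightarrow> nat \<Rightarrow> (nat \<Rightarrow> 'a::real_normed_vector) \<Rightarrow> real" where
  "section_norm r N a = (if r = \<infinity> then norm (a N)
     else (\<Sum>k<N. norm (a k) powr real_of_ereal r) powr (1 / real_of_ereal r))"

lemma real_of_ereal_ge_1: "1 \<le> r \<Longrightarrow> r \<noteq> \<infinity> \<Longrightarrow> 1 \<le> real_of_ereal r"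
  by (cases r) (auto simp: one_ereal_def)

lemma section_norm_nonneg [simp]: "0 \<le> section_norm r N a"
  by (simp add: section_norm_def)

lemma section_norm_zero [simp]: "section_norm r N (\<lambda>k. 0) = 0"
  by (simp add: section_norm_def)

lemma section_norm_add:
  assumes "1 \<le> r"
  shows "section_norm r N (\<lambda>k. a k + b k) \<le> section_norm r N a + section_norm r N b"
  using minkowski_sum[OF real_of_ereal_ge_1[OF assms], of "{..<N}" a b]
  by (auto simp: section_norm_def norm_triangle_ineq)

lemma section_norm_minus [simp]: "section_norm r N (\<lambda>k. - a k) = section_norm r N a"
  by (simp add: section_norm_def)

lemma section_norm_diff:
  assumes "1 \<le> r"
  shows "section_norm r N (\<lambda>k. a k - b k) \<le> section_norm r N a + section_norm r N b"
  using section_norm_add[OF assms, of N a "\<lambda>k. - b k"] by simp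

lemma section_norm_mono:
  assumes "1 \<le> r" and le: "\<And>k. norm (a k) \<le> norm (b k)"
  shows "section_norm r N a \<le> section_norm r N b"
proof (cases "r = \<infinity>")
  case True
  then show ?thesis using le by (simp add: section_norm_def)
next
  case False
  then have q: "1 \<le> real_of_ereal r" using assms(1) by (rule real_of_ereal_ge_1[rotated])
  have "(\<Sum>k<N. norm (a k) powr real_of_ereal r) \<le> (\<Sum>k<N. norm (b k) powr real_of_ereal r)"
    using q le by (intro sum_mono powr_mono2) auto
  then show ?thesis
    using q False unfolding section_norm_def by (simp add: powr_mono2 sum_nonneg)
qed

text \<open>Only norms of entries are compared, so \<open>a\<close> and \<open>b\<close> may take
  values in different spaces; this later carries membership in \<open>lp\<close> from vectors to
  scalars.\<close>

lemma section_norm_scale: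
  assumes "1 \<le> r" "0 \<le> t" and b: "\<And>k. norm (b k) = t * norm (a k)"
  shows "section_norm r N b = t * section_norm r N a"
proof (cases "r = \<infinity>")
  case True
  then show ?thesis using b by (simp add: section_norm_def)
next
  case False
  define q where "q = real_of_ereal r"
  have q: "1 \<le> q" using False assms(1) by (simp add: q_def real_of_ereal_ge_1)
  have "(\<Sum>k<N. norm (b k) powr q) = t powr q * (\<Sum>k<N. norm (a k) powr q)"
    using assms(2) by (simp add: b powr_mult sum_distrib_left)
  moreover have "(t powr q) powr (1 / q) = t" using q assms(2) by (simp add: powr_powr)
  ultimately show ?thesis
    using False by (simp add: section_norm_def q_def[symmetric] powr_mult sum_nonneg)
qed

lemma section_norm_mult:
  fixes a :: "nat \<Rightarrow> 'k::real_normed_field"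
  assumes "1 \<le> r"
  shows "section_norm r N (\<lambda>k. c * a k) = norm c * section_norm r N a"
  using assms by (intro section_norm_scale) (auto simp: norm_mult)

lemma section_norm_single:
  assumes "1 \<le> r"
  shows "section_norm r N (\<lambda>k. if k = i then c else 0) \<le> norm c"
proof (cases "r = \<infinity>")
  case False
  then have q: "1 \<le> real_of_ereal r" using assms by (rule real_of_ereal_ge_1[rotated])
  have "(\<Sum>k<N. norm (if k = i then c else 0) powr real_of_ereal r)
      = (\<Sum>k<N. if k = i then norm c powr real_of_ereal r else 0)"
    by (intro sum.cong) auto
  also have "\<dots> \<le> norm c powr real_of_ereal r" by simp
  finally have "section_norm r N (\<lambda>k. if k = i then c else 0) \<le> (norm c powr real_of_ereal r) powr (1 / real_of_ereal r)"
    using False q unfolding section_norm_def by (auto intro!: powr_mono2 sum_nonneg)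
  then show ?thesis using q by (simp add: powr_powr)
qed (simp add: section_norm_def)

text \<open>The triangle inequality, one entry at a time. The bound is independent of
  \<open>N\<close> and involves finitely many entries, so pointwise convergence controls it.\<close>

lemma section_norm_head:
  assumes "1 \<le> r"
  shows "section_norm r N (\<lambda>k. if k < K then a k else 0) \<le> (\<Sum>k<K. norm (a k))"
proof (induction K)
  case (Suc K)
  have eq: "(\<lambda>k. if k < Suc K then a k else 0)
      = (\<lambda>k. (if k < K then a k else 0) + (if k = K then a K else 0))"
    by (auto simp: less_Suc_eq)
  have "section_norm r N (\<lambda>k. if k < Suc K then a k else 0)
      \<le> section_norm r N (\<lambda>k. if k < K then a k else 0) + section_norm r N (\<lambda>k. if k = K then a K else 0)"
    unfolding eq by (rule section_norm_add[OF assms])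
  with Suc section_norm_single[OF assms, of N K "a K"] show ?case by simp
qed simp

lemma norm_le_section_norm:
  assumes "1 \<le> r" and "\<And>N. section_norm r N a \<le> C"
  shows "norm (a k) \<le> C"
proof (cases "r = \<infinity>")
  case True
  then show ?thesis using assms(2)[of k] by (simp add: section_norm_def)
next
  case False
  then have q: "1 \<le> real_of_ereal r" using assms(1) by (rule real_of_ereal_ge_1[rotated])
  have "norm (a k) powr real_of_ereal r \<le> (\<Sum>k<Suc k. norm (a k) powr real_of_ereal r)"
    by (simp add: sum_nonneg)
  then have "(norm (a k) powr real_of_ereal r) powr (1 / real_of_ereal r) \<le> section_norm r (Suc k) a"
    using q False unfolding section_norm_def by (auto intro!: powr_mono2)
  then show ?thesis using assms(2)[of "Suc k"] q by (simp add: powr_powr)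
qed

lemma tendsto_section_norm:
  assumes "1 \<le> r" and "\<And>k. ((\<lambda>j. a j k) \<longlongrightarrow> b k) F"
  shows "((\<lambda>j. section_norm r N (a j)) \<longlongrightarrow> section_norm r N b) F"
proof (cases "r = \<infinity>")
  case True
  then show ?thesis using assms(2) by (auto simp: section_norm_def intro: tendsto_norm)
next
  case False
  then have "1 \<le> real_of_ereal r" using assms(1) by (rule real_of_ereal_ge_1[rotated])
  then show ?thesis
    using False assms(2) unfolding section_norm_def
    by (auto intro!: tendsto_powr2 tendsto_sum tendsto_norm eventuallyI sum_nonneg)
qed

lemma section_norm_le_lp_norm:
  assumes "1 \<le> r" "a \<in> lp r"
  shows "section_norm r N a \<le> lp_norm r a"
proof (cases "r = \<infinity>")
  case True
  then have "Bseq a" using assms(2) by (auto simp: lp_def intro: convergent_imp_Bseq convergentI)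
  then have "bdd_above (range (\<lambda>k. norm (a k)))" by (simp add: Bseq_eq_bounded bounded_iff bdd_above_def)
  then show ?thesis using True by (auto simp: section_norm_def lp_norm_def intro: cSUP_upper)
next
  case False
  then have q: "1 \<le> real_of_ereal r" using assms(1) by (rule real_of_ereal_ge_1[rotated])
  have "(\<Sum>k<N. norm (a k) powr real_of_ereal r) \<le> (\<Sum>k. norm (a k) powr real_of_ereal r)"
    using assms(2) False by (intro sum_le_suminf) (auto simp: lp_def)
  then show ?thesis using q False by (auto simp: section_norm_def lp_norm_def intro!: powr_mono2 sum_nonneg)
qed

text \<open>For finite \<open>r\<close> bounded partial sums suffice. At \<open>\<infinity>\<close>
  bounded sections only give a bounded sequence, whereas \<open>lp \<infinity>\<close> is c_0; hence
  the last premise.\<close>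

lemma lp_ballI:
  assumes r: "1 \<le> r" and a: "\<And>N. section_norm r N a \<le> C" and "r = \<infinity> \<Longrightarrow> a \<longlonglongrightarrow> 0"
  shows "a \<in> lp_ball r C"
proof (cases "r = \<infinity>")
  case True
  then show ?thesis
    using assms by (auto simp: lp_ball_def lp_def lp_norm_def section_norm_def intro: cSUP_least)
next
  case False
  define q where "q = real_of_ereal r"
  have q: "1 \<le> q" using False r by (simp add: q_def real_of_ereal_ge_1)
  have C: "0 \<le> C" using a[of 0] section_norm_nonneg[of r 0 a] by linarith
  have le: "(\<Sum>k<N. norm (a k) powr q) \<le> C powr q" for N
  proof -
    have "(section_norm r N a) powr q \<le> C powr q"
      using a[of N] q by (intro powr_mono2) auto
    then show ?thesis using False q by (simp add: section_norm_def q_def[symmetric] powr_powr sum_nonneg)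
  qed
  then have s: "summable (\<lambda>k. norm (a k) powr q)"
    by (intro summableI_nonneg_bounded[of _ "C powr q"]) auto
  then have "(\<Sum>k. norm (a k) powr q) powr (1 / q) \<le> (C powr q) powr (1 / q)"
    using q le by (intro powr_mono2 suminf_le_const suminf_nonneg) auto
  also have "\<dots> = C" using q C by (simp add: powr_powr)
  finally show ?thesis
    using False s by (simp add: lp_ball_def lp_def lp_norm_def q_def)
qed

lemma lp_ball_section_norm: "1 \<le> r \<Longrightarrow> a \<in> lp_ball r C \<Longrightarrow> section_norm r N a \<le> C"
  using section_norm_le_lp_norm[of r a N] by (simp add: lp_ball_def)

lemma lp_norm_nonneg:
  assumes "1 \<le> r" "a \<in> lp r" shows "0 \<le> lp_norm r a"
  using section_norm_le_lp_norm[OF assms, of 0] section_norm_nonneg[of r 0 a] by linarith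

lemma lp_ball_scale:
  assumes r: "1 \<le> r" and t: "0 \<le> t" and b: "\<And>k. norm (b k) = t * norm (a k)" and a: "a \<in> lp_ball r C"
  shows "b \<in> lp_ball r (t * C)"
proof (rule lp_ballI[OF r])
  show "section_norm r N b \<le> t * C" for N
    using section_norm_scale[OF r t b] lp_ball_section_norm[OF r a] t by (simp add: mult_left_mono)
  show "b \<longlonglongrightarrow> 0" if "r = \<infinity>"
  proof -
    have "a \<longlonglongrightarrow> 0" using a that by (simp add: lp_ball_def lp_def)
    from tendsto_mult_right_zero[OF tendsto_norm_zero[OF this], of t]
    show ?thesis by (simp add: b[symmetric] tendsto_norm_zero_iff)
  qed
qed

lemma lp_scale:
  assumes "1 \<le> r" "0 \<le> t" "\<And>k. norm (b k) = t * norm (a k)" "a \<in> lp r"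
  shows "b \<in> lp r"
  using lp_ball_scale[of r t b a "lp_norm r a"] assms by (simp add: lp_ball_def)

section \<open>Hulls and null factors\<close>

text \<open>The conjugate of t > 1 is t / (t - 1), written as 1 + 1 / (t - 1) because it appears
  below as a sum of exponents. It is finite, which forces \<open>r\<close> to be finite too.\<close>

lemma conj_index_cases:
  assumes "1 \<le> p" "p < \<infinity>" "1 \<le> r" "r \<le> conj_index p"
  obtains "real_of_ereal p = 1"
  | t where "p = ereal t" "1 < t" "r \<noteq> \<infinity>" "real_of_ereal r \<le> 1 + 1 / (t - 1)"
proof -
  obtain t where t: "p = ereal t" "1 \<le> t" using assms(1,2) by (cases p) (auto simp: one_ereal_def)
  show thesis
  proof (cases "t = 1")
    case True
    then show ?thesis using that(1) t by simp
  next
    case False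
    then have "1 < t" using t by simp
    moreover have "conj_index p = ereal (1 + 1 / (t - 1))"
      using \<open>1 < t\<close> t by (simp add: conj_index_def one_ereal_def field_simps)
    ultimately show ?thesis using that(2)[OF t(1)] assms(3,4) by (cases r) auto
  qed
qed

text \<open>For p = t > 1 one of the two terms alone dominates, depending on whether u exceeds v to
  the power t - 1. The bound \<open>u \<le> 1\<close> allows the exponent of u to be lowered from
  the conjugate index to \<open>r\<close>; for p = 1 it gives u v \<le> v at once.\<close>

lemma young_conj_index:
  fixes u v :: real
  assumes pr: "1 \<le> p" "p < \<infinity>" "1 \<le> r" "r \<le> conj_index p" and u: "0 \<le> u" "u \<le> 1" and v: "0 \<le> v"
  shows "u * v \<le> (if r = \<infinity> then 0 else u powr real_of_ereal r) + v powr real_of_ereal p"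
  using pr
proof (cases rule: conj_index_cases)
  case 1
  then show ?thesis using u v mult_right_mono[of u 1 v] by (auto intro: add_increasing)
next
  case (2 t)
  show ?thesis
  proof (cases "u \<le> v powr (t - 1)")
    case True
    then have "u * v \<le> v powr (t - 1) * v" using v by (rule mult_right_mono)
    also have "\<dots> = v powr t"
    proof (cases "v = 0")
      case False
      with v have "v powr (t - 1) * v powr 1 = v powr t" by (simp only: powr_add[symmetric]) simp
      then show ?thesis using v by simp
    qed (use 2 in auto)
    finally show ?thesis using 2 by (auto intro: add_increasing)
  next
    case False
    then have "u > v powr (t - 1)" by simp
    then have "(v powr (t - 1)) powr (1 / (t - 1)) \<le> u powr (1 / (t - 1))"
      using 2 by (intro powr_mono2) auto
    then have "v \<le> u powr (1 / (t - 1))" using 2 v by (simp add: powr_powr)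
    then have "u * v \<le> u powr 1 * u powr (1 / (t - 1))" using u by (simp add: mult_left_mono)
    also have "\<dots> = u powr (1 + 1 / (t - 1))" by (simp only: powr_add)
    also have "\<dots> \<le> u powr real_of_ereal r" using u 2 by (intro powr_mono') auto
    finally show ?thesis using 2 by (auto intro: add_increasing2)
  qed
qed

lemma sum_powr_section_norm_le_1:
  assumes "1 \<le> r" "r \<noteq> \<infinity>" "0 < C" "section_norm r N a \<le> C"
  shows "(\<Sum>k<N. (norm (a k) / C) powr real_of_ereal r) \<le> 1"
proof -
  define q where "q = real_of_ereal r"
  have q: "1 \<le> q" using assms by (simp add: q_def real_of_ereal_ge_1)
  have "(section_norm r N a) powr q \<le> C powr q"
    using assms q by (intro powr_mono2) auto
  then have "(\<Sum>k<N. norm (a k) powr q) \<le> C powr q"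
    using q assms by (simp add: section_norm_def q_def[symmetric] powr_powr sum_nonneg)
  then show ?thesis
    using assms(3) by (simp add: powr_divide sum_divide_distrib[symmetric] q_def[symmetric])
qed

text \<open>A Hoelder inequality with the crude constant 2, which is harmless: no estimate below depends
  on the value of the constant.\<close>

lemma hoelder_conj_index:
  assumes pr: "1 \<le> p" "p < \<infinity>" "1 \<le> r" "r \<le> conj_index p"
    and A: "0 < A" "\<And>N. section_norm r N a \<le> A" and C: "0 < C" "z \<in> lp_ball p C"
  shows "summable (\<lambda>k. norm (a k) * norm (z k))"
    and "(\<Sum>k. norm (a k) * norm (z k)) \<le> 2 * A * C"
proof -
  have part: "(\<Sum>k<N. norm (a k) * norm (z k)) \<le> 2 * A * C" for N
  proof -
    \<comment> \<open>After division by \<open>A\<close> and \<open>C\<close> each of the two sums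
      in Young's bound is at most 1; together they give the constant 2.\<close>
    have le: "norm (a k) / A * (norm (z k) / C)
        \<le> (if r = \<infinity> then 0 else (norm (a k) / A) powr real_of_ereal r) + (norm (z k) / C) powr real_of_ereal p" for k
      using A C norm_le_section_norm[OF pr(3) A(2)] by (intro young_conj_index pr) auto
    have "(\<Sum>k<N. norm (a k) / A * (norm (z k) / C))
        \<le> (\<Sum>k<N. if r = \<infinity> then 0 else (norm (a k) / A) powr real_of_ereal r)
          + (\<Sum>k<N. (norm (z k) / C) powr real_of_ereal p)"
      unfolding sum.distrib[symmetric] by (intro sum_mono le)
    also have "\<dots> \<le> 1 + 1"
    proof (rule add_mono)
      show "(\<Sum>k<N. if r = \<infinity> then 0 else (norm (a k) / A) powr real_of_ereal r) \<le> 1"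
        using sum_powr_section_norm_le_1[OF pr(3) _ A] by (cases "r = \<infinity>") auto
      show "(\<Sum>k<N. (norm (z k) / C) powr real_of_ereal p) \<le> 1"
        using pr C by (intro sum_powr_section_norm_le_1 lp_ball_section_norm) auto
    qed
    finally show ?thesis
      using A(1) C(1) by (simp add: sum_divide_distrib[symmetric] field_simps)
  qed
  show s: "summable (\<lambda>k. norm (a k) * norm (z k))"
    using part by (intro summableI_nonneg_bounded) auto
  then show "(\<Sum>k. norm (a k) * norm (z k)) \<le> 2 * A * C"
    using part by (intro suminf_le_const)
qed

context banach_over
begin

lemma smul_scaleR: "smul a (t *\<^sub>R v) = t *\<^sub>R smul a v"
  unfolding smul_of_real[symmetric] by (rule scale_left_commute)

lemma smul_of_real_mult: "smul (of_real t * a) v = smul a (t *\<^sub>R v)"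
  unfolding smul_of_real[symmetric] by (simp add: mult.commute)

lemma norm_sums_le:
  assumes pr: "1 \<le> p" "p < \<infinity>" "1 \<le> r" "r \<le> conj_index p"
    and A: "0 < A" "\<And>N. section_norm r N a \<le> A" and C: "0 < C" "z \<in> lp_ball p C"
  shows "summable (\<lambda>k. smul (a k) (z k))" and "norm (\<Sum>k. smul (a k) (z k)) \<le> 2 * A * C"
proof -
  note h = hoelder_conj_index[OF assms]
  have s: "summable (\<lambda>k. norm (smul (a k) (z k)))" using h(1) by (simp add: norm_smul)
  then show "summable (\<lambda>k. smul (a k) (z k))" by (rule summable_norm_cancel)
  show "norm (\<Sum>k. smul (a k) (z k)) \<le> 2 * A * C"
    using summable_norm[OF s] h(2) by (simp add: norm_smul)
qed

lemma pr_conv_scaleR: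
  assumes "v \<in> pr_conv smul r z" shows "t *\<^sub>R v \<in> pr_conv smul r (\<lambda>k. t *\<^sub>R z k)"
  using assms sums_scaleR_right[of _ v t] unfolding pr_conv_def by (fastforce simp: smul_scaleR)

end

text \<open>With the tails \<^term>\<open>R k\<close> of the series of the p-th powers \<^term>\<open>s k\<close>, the weights are
  \<^term>\<open>R k powr (1 / (2 * p))\<close>; the series of \<^term>\<open>s k / sqrt (R k)\<close> is dominated by a
  telescoping one.\<close>

lemma lp_factor:
  fixes z :: "nat \<Rightarrow> 'x::real_normed_vector"
  assumes p: "1 \<le> p" "p < \<infinity>" and z: "z \<in> lp p"
  obtains \<tau> :: "nat \<Rightarrow> real" and w where "\<tau> \<longlonglongrightarrow> 0" "\<And>k. 0 \<le> \<tau> k" "w \<in> lp_ball p 1" "\<And>k. z k = \<tau> k *\<^sub>R w k"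
proof -
  define q where "q = real_of_ereal p"
  have q: "1 \<le> q" using p by (simp add: q_def real_of_ereal_ge_1)
  define s where "s k = norm (z k) powr q" for k
  define R where "R k = suminf s - sum s {..<k}" for k
  have s: "summable s" using z p by (simp add: lp_def s_def[abs_def] q_def)
  have s0: "0 \<le> s k" for k by (simp add: s_def)
  have R0: "0 \<le> R k" for k using sum_le_suminf[OF s, of "{..<k}"] s0 by (simp add: R_def)
  have R_Suc: "R k = s k + R (Suc k)" for k by (simp add: R_def)
  have "(\<lambda>k. suminf s - sum s {..<k}) \<longlonglongrightarrow> suminf s - suminf s"
    by (intro tendsto_diff tendsto_const summable_LIMSEQ s)
  then have R: "R \<longlonglongrightarrow> 0" by (simp add: R_def[abs_def])
  define \<tau> where "\<tau> k = R k powr (1 / (2 * q))" for k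
  define w where "w k = z k /\<^sub>R \<tau> k" for k
  have \<tau>: "\<tau> \<longlonglongrightarrow> 0"
  proof -
    have "(\<lambda>k. R k powr (1 / (2 * q))) \<longlonglongrightarrow> 0 powr (1 / (2 * q))"
      using q R R0 by (intro tendsto_powr2 tendsto_const) auto
    then show ?thesis by (simp add: \<tau>_def[abs_def])
  qed
  \<comment> \<open>If \<open>R k = 0\<close>, then \<open>z k = 0\<close>, so the default value of
    division by 0 does no harm.\<close>
  have zw: "z k = \<tau> k *\<^sub>R w k" for k
  proof (cases "R k = 0")
    case True
    then have "s k = 0" using R_Suc[of k] R0[of "Suc k"] s0[of k] by linarith
    then show ?thesis by (simp add: w_def s_def)
  qed (simp add: w_def \<tau>_def)
  have \<tau>q: "\<tau> k powr q = sqrt (R k)" for k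
    using q R0[of k] by (simp add: \<tau>_def powr_powr powr_half_sqrt)
  have \<tau>0: "0 \<le> \<tau> k" for k by (simp add: \<tau>_def)
  have "norm (w k) = norm (z k) / \<tau> k" for k
    using \<tau>0[of k] by (simp add: w_def divide_inverse mult.commute)
  then have "norm (w k) powr q = s k / sqrt (R k)" for k
    using \<tau>0[of k] by (simp add: powr_divide s_def \<tau>q[symmetric])
  moreover have "s k / sqrt (R k) \<le> 2 * sqrt (R k) - 2 * sqrt (R (Suc k))" for k
  proof (cases "R k = 0")
    case True
    then show ?thesis using R_Suc[of k] R0[of "Suc k"] s0[of k] by simp
  next
    case False
    have "s k = R k - R (Suc k)" using R_Suc[of k] by simp
    also have "\<dots> = (sqrt (R k) - sqrt (R (Suc k))) * (sqrt (R k) + sqrt (R (Suc k)))"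
      using R0 by (simp add: algebra_simps flip: power2_eq_square)
    also have "\<dots> \<le> (sqrt (R k) - sqrt (R (Suc k))) * (2 * sqrt (R k))"
      using R_Suc[of k] s0[of k] by (intro mult_left_mono) auto
    finally show ?thesis using False R0[of k] by (simp add: field_simps)
  qed
  ultimately have le: "(\<Sum>k<N. norm (w k) powr q) \<le> (\<Sum>k<N. 2 * sqrt (R k) - 2 * sqrt (R (Suc k)))" for N
    by (intro sum_mono) simp
  have "(\<Sum>k<N. norm (w k) powr q) \<le> 2 * sqrt (R 0)" for N
    using le[of N] real_sqrt_ge_zero[OF R0[of N]] sum_lessThan_telescope'[of "\<lambda>k. 2 * sqrt (R k)" N]
    by linarith
  then have "summable (\<lambda>k. norm (w k) powr q)"
    by (intro summableI_nonneg_bounded) auto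
  then have w: "w \<in> lp p" using p by (simp add: lp_def q_def)
  \<comment> \<open>The norm of \<open>w\<close> is moved to the weights; adding 1 keeps the divisor
    positive when \<open>w\<close> is 0.\<close>
  define c where "c = lp_norm p w + 1"
  have c: "0 < c" using lp_norm_nonneg[OF p(1) w] by (simp add: c_def)
  show thesis
  proof
    show "(\<lambda>k. c * \<tau> k) \<longlonglongrightarrow> 0" using tendsto_mult_right_zero[OF \<tau>] .
    show "0 \<le> c * \<tau> k" for k using c by (simp add: \<tau>_def)
    have "(\<lambda>k. w k /\<^sub>R c) \<in> lp_ball p (inverse c * c)"
    proof (rule lp_ball_scale)
      show "w \<in> lp_ball p c" using w by (simp add: lp_ball_def c_def)
    qed (use c p in auto)
    then show "(\<lambda>k. w k /\<^sub>R c) \<in> lp_ball p 1" using c by simp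
    show "z k = (c * \<tau> k) *\<^sub>R (w k /\<^sub>R c)" for k using c zw[of k] by simp
  qed
qed

section \<open>Multiplication by null weights\<close>

lemma weighted_in_lp_ball:
  fixes a :: "nat \<Rightarrow> 'k::real_normed_field" and \<tau> :: "nat \<Rightarrow> real"
  assumes r: "1 \<le> r" and a: "\<And>N. section_norm r N a \<le> A"
    and \<tau>: "\<tau> \<longlonglongrightarrow> 0" "\<And>k. \<bar>\<tau> k\<bar> \<le> M"
  shows "(\<lambda>k. of_real (\<tau> k) * a k) \<in> lp_ball r (M * A)"
proof (rule lp_ballI[OF r])
  have M: "0 \<le> M" using \<tau>(2)[of 0] by linarith
  fix N
  have "section_norm r N (\<lambda>k. of_real (\<tau> k) * a k) \<le> section_norm r N (\<lambda>k. of_real M * a k)"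
    using \<tau>(2) M by (intro section_norm_mono r) (auto simp: norm_mult intro!: mult_right_mono)
  also have "\<dots> = M * section_norm r N a" using M by (simp add: section_norm_mult[OF r])
  also have "\<dots> \<le> M * A" using a[of N] M by (rule mult_left_mono)
  finally show "section_norm r N (\<lambda>k. of_real (\<tau> k) * a k) \<le> M * A" .
next
  show "(\<lambda>k. of_real (\<tau> k) * a k) \<longlonglongrightarrow> 0"
  proof (rule Lim_null_comparison)
    show "\<forall>\<^sub>F k in sequentially. norm (of_real (\<tau> k) * a k) \<le> \<bar>\<tau> k\<bar> * A"
      using norm_le_section_norm[OF r a] by (auto simp: norm_mult intro!: mult_left_mono always_eventually)
    show "(\<lambda>k. \<bar>\<tau> k\<bar> * A) \<longlonglongrightarrow> 0"
      using tendsto_mult_left_zero[OF tendsto_rabs_zero[OF \<tau>(1)]] .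
  qed
qed

text \<open>Compactness of the diagonal operator: beyond some index \<open>K\<close> the weights are
  small against the common bound \<open>C\<close>, and the finitely many entries before
  \<open>K\<close> converge to 0.\<close>

lemma weighted_null_in_lp_ball:
  fixes d :: "nat \<Rightarrow> nat \<Rightarrow> 'k::real_normed_field" and \<tau> :: "nat \<Rightarrow> real"
  assumes r: "1 \<le> r" and d: "\<And>j N. section_norm r N (d j) \<le> C" "\<And>k. (\<lambda>j. d j k) \<longlonglongrightarrow> 0"
    and \<tau>: "\<tau> \<longlonglongrightarrow> 0" and "0 < \<epsilon>"
  shows "\<forall>\<^sub>F j in sequentially. (\<lambda>k. of_real (\<tau> k) * d j k) \<in> lp_ball r \<epsilon>"
proof -
  have C: "0 \<le> C" using d(1)[of 0 0] section_norm_nonneg[of r 0 "d 0"] by linarith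
  \<comment> \<open>Half of \<epsilon> is reserved for the tail, half for the head;
    \<open>C + 1\<close> avoids division by 0.\<close>
  define \<delta> where "\<delta> = \<epsilon> / (2 * (C + 1))"
  have \<delta>: "0 < \<delta>" "\<delta> * C \<le> \<epsilon> / 2" using C \<open>0 < \<epsilon>\<close> by (auto simp: \<delta>_def field_simps)
  obtain K where K: "\<And>k. K \<le> k \<Longrightarrow> \<bar>\<tau> k\<bar> < \<delta>"
    using LIMSEQ_D[OF \<tau> \<delta>(1)] by auto
  have "(\<lambda>j. \<Sum>k<K. norm (of_real (\<tau> k) * d j k)) \<longlonglongrightarrow> (\<Sum>k<K. norm (of_real (\<tau> k) * (0::'k)))"
    by (intro tendsto_intros d(2))
  then have "\<forall>\<^sub>F j in sequentially. (\<Sum>k<K. norm (of_real (\<tau> k) * d j k)) < \<epsilon> / 2"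
    using \<open>0 < \<epsilon>\<close> by (intro order_tendstoD(2)) auto
  then show ?thesis
  proof eventually_elim
    case (elim j)
    define f where "f k = of_real (\<tau> k) * d j k" for k
    show ?case
    proof (rule lp_ballI[OF r])
      fix N
      have "section_norm r N f = section_norm r N (\<lambda>k. (if k < K then f k else 0) + (if k < K then 0 else f k))"
        by (rule arg_cong[of _ _ "section_norm r N"]) auto
      also have "\<dots> \<le> section_norm r N (\<lambda>k. if k < K then f k else 0) + section_norm r N (\<lambda>k. if k < K then 0 else f k)"
        by (rule section_norm_add[OF r])
      also have "\<dots> \<le> (\<Sum>k<K. norm (f k)) + section_norm r N (\<lambda>k. of_real \<delta> * d j k)"
      proof (intro add_mono section_norm_head section_norm_mono r)
        fix k
        show "norm (if k < K then 0 else f k) \<le> norm (of_real \<delta> * d j k)"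
          using K[of k] \<delta> by (auto simp: f_def norm_mult intro!: mult_right_mono)
      qed
      also have "section_norm r N (\<lambda>k. of_real \<delta> * d j k) \<le> \<epsilon> / 2"
        using \<delta> order_trans[OF mult_left_mono[OF d(1)[of N j], of \<delta>] \<delta>(2)]
        by (simp add: section_norm_mult[OF r])
      finally show "section_norm r N (\<lambda>k. of_real (\<tau> k) * d j k) \<le> \<epsilon>"
        using elim by (simp add: f_def[abs_def])
    next
      obtain M where "\<And>k. \<bar>\<tau> k\<bar> \<le> M"
        using convergent_imp_Bseq[OF convergentI[OF \<tau>]] by (auto simp: Bseq_def)
      from weighted_in_lp_ball[OF r d(1) \<tau> this]
      show "(\<lambda>k. of_real (\<tau> k) * d j k) \<longlonglongrightarrow> 0" if "r = \<infinity>"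
        using that by (auto simp: lp_ball_def lp_def)
    qed
  qed
qed

section \<open>Representations with null coefficients\<close>

text \<open>On bounded coefficient sequences the null weights \<^term>\<open>\<tau>\<close> turn pointwise into norm
  convergence. A subsequence of weighted coefficients staying away from small representations
  would thus converge to coefficients that represent 0, and subtracting these gives small ones.\<close>

lemma (in banach_over) weighted_sums_null:
  fixes x :: "nat \<Rightarrow> 'x" and a :: "nat \<Rightarrow> nat \<Rightarrow> 'k"
  assumes pr: "1 \<le> p" "p < \<infinity>" "1 \<le> r" "r \<le> conj_index p"
    and x: "x \<longlonglongrightarrow> 0" and \<tau>: "\<tau> \<longlonglongrightarrow> 0" and w: "w \<in> lp_ball p 1"
    and a: "\<And>n N. section_norm r N (a n) \<le> 1" "\<And>n. (\<lambda>k. smul (of_real (\<tau> k) * a n k) (w k)) sums x n"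
    and "0 < \<epsilon>"
  shows "\<forall>\<^sub>F n in sequentially. \<exists>b\<in>lp_ball r \<epsilon>. (\<lambda>k. smul (b k) (w k)) sums x n"
proof (rule ccontr)
  let ?P = "\<lambda>n. \<exists>b\<in>lp_ball r \<epsilon>. (\<lambda>k. smul (b k) (w k)) sums x n"
  assume "\<not> eventually ?P sequentially"
  then have "infinite {n. \<not> ?P n}"
    by (simp add: not_eventually frequently_cofinite cofinite_eq_sequentially[symmetric])
  from infinite_enumerate[OF this] obtain f :: "nat \<Rightarrow> nat" where f: "strict_mono f" "\<And>j. \<not> ?P (f j)"
    by blast
  have bound: "norm (a (f j) k) \<le> 1" for j k
    by (rule norm_le_section_norm[OF pr(3) a(1)])
  \<comment> \<open>A diagonal subsequence, available because bounded sets of scalars are relatively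
    compact.\<close>
  have "\<exists>g. strict_mono g \<and> (\<forall>k. \<exists>l. (\<lambda>j. a (f (g j)) k) \<longlonglongrightarrow> l)"
    by (rule function_convergent_subsequence[of "UNIV :: nat set" "\<lambda>j k. a (f j) k" 1])
      (auto simp: bound)
  then obtain g :: "nat \<Rightarrow> nat" where g: "strict_mono g" "\<And>k. \<exists>l. (\<lambda>j. a (f (g j)) k) \<longlonglongrightarrow> l"
    by blast
  then obtain c where c: "\<And>k. (\<lambda>j. a (f (g j)) k) \<longlonglongrightarrow> c k" by metis
  define h where "h j = f (g j)" for j
  have h: "strict_mono h" unfolding h_def using f(1) g(1) by (simp add: strict_mono_def)
  \<comment> \<open>Section bounds survive pointwise limits. At \<open>r = \<infinity>\<close> the
    limit \<open>c\<close> need not be null, but its product with \<open>\<tau>\<close> is.\<close>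
  have c1: "section_norm r N c \<le> 1" for N
    by (rule LIMSEQ_le_const2[OF tendsto_section_norm[OF pr(3), of "\<lambda>j. a (f (g j))" c, OF c]])
      (auto simp: a(1))
  define d where "d j k = a (h j) k - c k" for j k
  have d: "section_norm r N (d j) \<le> 2" for j N
    using section_norm_diff[OF pr(3), of N "a (h j)" c] a(1)[of N "h j"] c1[of N] by (simp add: d_def[abs_def])
  have d0: "(\<lambda>j. d j k) \<longlonglongrightarrow> 0" for k
    using tendsto_diff[OF c[of k] tendsto_const[of "c k"]] by (simp add: d_def h_def)
  note small = weighted_null_in_lp_ball[OF pr(3) d d0 \<tau>]
  define y where "y = (\<Sum>k. smul (of_real (\<tau> k) * c k) (w k))"
  obtain M where M: "0 < M" "\<And>k. \<bar>\<tau> k\<bar> \<le> M"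
    using convergent_imp_Bseq[OF convergentI[OF \<tau>]] by (auto simp: Bseq_def)
  have "(\<lambda>k. of_real (\<tau> k) * c k) \<in> lp_ball r (M * 1)"
    using c1 \<tau> M(2) by (rule weighted_in_lp_ball[OF pr(3)])
  then have y: "(\<lambda>k. smul (of_real (\<tau> k) * c k) (w k)) sums y"
    unfolding y_def using M(1) w lp_ball_section_norm[OF pr(3)]
    by (intro summable_sums norm_sums_le(1)[OF pr, of M _ 1]) auto
  have diff: "(\<lambda>k. smul (of_real (\<tau> k) * d j k) (w k)) sums (x (h j) - y)" for j
    using sums_diff[OF a(2)[of "h j"] y] by (simp add: d_def right_diff_distrib scale_left_diff_distrib)
  \<comment> \<open>The limit is found twice: it is 0 because the coefficients become small, and
    \<open>- y\<close> because \<open>x\<close> is null.\<close>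
  have "(\<lambda>j. x (h j) - y) \<longlonglongrightarrow> 0"
  proof (rule LIMSEQ_I)
    fix e :: real
    assume "0 < e"
    then have "0 < e / 3" by simp
    from small[OF this] have "\<forall>\<^sub>F j in sequentially. norm (x (h j) - y) < e"
    proof eventually_elim
      case (elim j)
      have "norm (\<Sum>k. smul (of_real (\<tau> k) * d j k) (w k)) \<le> 2 * (e / 3) * 1"
        using \<open>0 < e\<close> w lp_ball_section_norm[OF pr(3) elim] by (intro norm_sums_le(2)[OF pr]) auto
      then show ?case using sums_unique[OF diff[of j]] \<open>0 < e\<close> by simp
    qed
    then show "\<exists>no. \<forall>n\<ge>no. norm (x (h n) - y - 0) < e" by (simp add: eventually_sequentially)
  qed
  moreover have "(\<lambda>j. x (h j) - y) \<longlonglongrightarrow> 0 - y"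
    using LIMSEQ_subseq_LIMSEQ[OF x h] by (intro tendsto_intros) (simp add: o_def)
  ultimately have "y = 0" using LIMSEQ_unique by fastforce
  obtain j where "(\<lambda>k. of_real (\<tau> k) * d j k) \<in> lp_ball r \<epsilon>"
    using small[OF \<open>0 < \<epsilon>\<close>] eventually_happens by fastforce
  then have "?P (h j)" using diff[of j] \<open>y = 0\<close> by auto
  then show False using f(2)[of "g j"] by (simp add: h_def)
qed

text \<open>The coefficients are near-minimal: the norm of \<^term>\<open>b n\<close> exceeds the infimum over all
  representations of \<^term>\<open>x n\<close> by at most \<^term>\<open>1 / Suc n\<close>.\<close>

lemma (in banach_over) null_rel_pr_compact_coefficients:
  assumes pr: "1 \<le> p" "p < \<infinity>" "1 \<le> r" "r \<le> conj_index p"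
    and x: "x \<longlonglongrightarrow> 0" and K: "rel_pr_compact smul p r (range x)"
  obtains w b where "w \<in> lp_ball p 1" "\<And>n. b n \<in> lp r" "\<And>n. (\<lambda>k. smul (b n k) (w k)) sums x n"
    and "(\<lambda>n. lp_norm r (b n)) \<longlonglongrightarrow> 0"
proof -
  obtain z where z: "z \<in> lp p" "\<And>n. x n \<in> pr_conv smul r z"
    using K by (auto simp: rel_pr_compact_def)
  then obtain a where a: "\<And>n. a n \<in> lp_ball r 1" "\<And>n. (\<lambda>k. smul (a n k) (z k)) sums x n"
    unfolding pr_conv_def by simp metis
  obtain \<tau> w where \<tau>: "\<tau> \<longlonglongrightarrow> 0" "\<And>k. 0 \<le> \<tau> k" and w: "w \<in> lp_ball p 1" and zw: "\<And>k. z k = \<tau> k *\<^sub>R w k"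
    by (rule lp_factor[OF pr(1,2) z(1)]) blast
  have sums: "(\<lambda>k. smul (of_real (\<tau> k) * a n k) (w k)) sums x n" for n
    using a(2)[of n] by (simp add: smul_of_real_mult zw)
  have small: "\<forall>\<^sub>F n in sequentially. \<exists>b\<in>lp_ball r \<epsilon>. (\<lambda>k. smul (b k) (w k)) sums x n" if "0 < \<epsilon>" for \<epsilon>
    using lp_ball_section_norm[OF pr(3) a(1)] by (intro weighted_sums_null[OF pr x \<tau>(1) w _ sums that])
  define B where "B n = {b \<in> lp r. (\<lambda>k. smul (b k) (w k)) sums x n}" for n
  \<comment> \<open>For each \<epsilon> the late terms have small coefficients, but these may vary
    with \<epsilon>. Comparison with the infimum makes one choice small for all \<epsilon>.\<close>
  define m where "m n = Inf (lp_norm r ` B n)" for n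
  have "B n \<noteq> {}" for n
  proof -
    obtain M where M: "0 < M" "\<And>k. \<bar>\<tau> k\<bar> \<le> M"
      using convergent_imp_Bseq[OF convergentI[OF \<tau>(1)]] by (auto simp: Bseq_def)
    have "(\<lambda>k. of_real (\<tau> k) * a n k) \<in> lp_ball r (M * 1)"
      using lp_ball_section_norm[OF pr(3) a(1)] \<tau>(1) M(2) by (rule weighted_in_lp_ball[OF pr(3)])
    then show ?thesis using sums[of n] unfolding B_def by (auto simp: lp_ball_def)
  qed
  moreover have bdd: "bdd_below (lp_norm r ` B n)" for n
    using lp_norm_nonneg[OF pr(3)] unfolding B_def by (intro bdd_belowI[of _ 0]) auto
  ultimately have "\<exists>b\<in>B n. lp_norm r b < m n + 1 / Suc n" for n
    using cInf_less_iff[of "lp_norm r ` B n" "m n + 1 / Suc n"] unfolding m_def by auto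
  then obtain b where b: "\<And>n. b n \<in> B n" "\<And>n. lp_norm r (b n) < m n + 1 / Suc n" by metis
  have "(\<lambda>n. lp_norm r (b n)) \<longlonglongrightarrow> 0"
  proof (rule LIMSEQ_I)
    fix e :: real
    assume "0 < e"
    have "\<forall>\<^sub>F n in sequentially. 1 / real (Suc n) < e / 2"
      using LIMSEQ_inverse_real_of_nat \<open>0 < e\<close>
      by (intro order_tendstoD(2)) (auto simp: inverse_eq_divide)
    moreover have "\<forall>\<^sub>F n in sequentially. \<exists>b\<in>lp_ball r (e / 2). (\<lambda>k. smul (b k) (w k)) sums x n"
      using \<open>0 < e\<close> by (intro small) simp
    ultimately have "\<forall>\<^sub>F n in sequentially. lp_norm r (b n) < e"
    proof eventually_elim
      case (elim n)
      then obtain c where "c \<in> B n" "lp_norm r c \<le> e / 2" by (auto simp: B_def lp_ball_def)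
      then have "m n \<le> e / 2" using cInf_lower[OF imageI bdd] unfolding m_def by fastforce
      then show ?case using b(2)[of n] elim by simp
    qed
    moreover have "0 \<le> lp_norm r (b n)" for n
      using b(1)[of n] lp_norm_nonneg[OF pr(3)] by (auto simp: B_def)
    ultimately show "\<exists>no. \<forall>n\<ge>no. norm (lp_norm r (b n) - 0) < e"
      by (simp add: eventually_sequentially)
  qed
  then show thesis using that[OF w, of b] b(1) by (auto simp: B_def)
qed

section \<open>Uniformly null, null and relatively compact sequences\<close>

lemma (in banach_over) coefficients_imp_uniformly_pr_null:
  assumes r: "1 \<le> r" and w: "w \<in> lp_ball p 1" and b: "\<And>n. b n \<in> lp r" "\<And>n. (\<lambda>k. smul (b n k) (w k)) sums x n"
    and null: "(\<lambda>n. lp_norm r (b n)) \<longlonglongrightarrow> 0"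
  shows "uniformly_pr_null smul p r x"
  unfolding uniformly_pr_null_def
proof (intro bexI[OF _ w] allI impI)
  fix \<epsilon> :: real
  assume \<epsilon>: "0 < \<epsilon>"
  then obtain N where N: "\<And>n. N \<le> n \<Longrightarrow> lp_norm r (b n) < \<epsilon>"
    using order_tendstoD(2)[OF null \<epsilon>] by (auto simp: eventually_sequentially)
  have "x n \<in> (\<lambda>v. \<epsilon> *\<^sub>R v) ` pr_conv smul r w" if "N \<le> n" for n
  proof
    show "x n = \<epsilon> *\<^sub>R (x n /\<^sub>R \<epsilon>)" using \<epsilon> by simp
    have "(\<lambda>k. of_real (inverse \<epsilon>) * b n k) \<in> lp_ball r (inverse \<epsilon> * \<epsilon>)"
      using \<epsilon> b(1)[of n] N[OF that] by (intro lp_ball_scale[OF r]) (auto simp: norm_mult norm_inverse lp_ball_def)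
    moreover have "(\<lambda>k. smul (of_real (inverse \<epsilon>) * b n k) (w k)) sums (x n /\<^sub>R \<epsilon>)"
      using sums_scaleR_right[OF b(2)[of n], of "inverse \<epsilon>"] by (simp add: smul_of_real_mult smul_scaleR del: of_real_inverse)
    ultimately show "x n /\<^sub>R \<epsilon> \<in> pr_conv smul r w"
      using \<epsilon> unfolding pr_conv_def by auto
  qed
  then show "\<exists>N. \<forall>n\<ge>N. x n \<in> (\<lambda>v. \<epsilon> *\<^sub>R v) ` pr_conv smul r w" by blast
qed

text \<open>The factor \<epsilon> moves from the hull to the generating sequence, which thereby gets
  norm at most \<epsilon>.\<close>

lemma (in banach_over) uniformly_pr_null_imp_pr_null:
  assumes p: "1 \<le> p" and "uniformly_pr_null smul p r x"
  shows "pr_null smul p r x"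
  unfolding pr_null_def
proof (intro allI impI)
  fix \<epsilon> :: real
  assume \<epsilon>: "0 < \<epsilon>"
  obtain z where z: "z \<in> lp_ball p 1"
    "\<And>\<epsilon>. 0 < \<epsilon> \<Longrightarrow> \<exists>N. \<forall>n\<ge>N. x n \<in> (\<lambda>v. \<epsilon> *\<^sub>R v) ` pr_conv smul r z"
    using assms(2) unfolding uniformly_pr_null_def by metis
  then obtain N where "\<forall>n\<ge>N. x n \<in> (\<lambda>v. \<epsilon> *\<^sub>R v) ` pr_conv smul r z" using \<epsilon> by metis
  then have "x n \<in> pr_conv smul r (\<lambda>k. \<epsilon> *\<^sub>R z k)" if "N \<le> n" for n
    using that pr_conv_scaleR by (auto elim!: allE[of _ n])
  moreover have "(\<lambda>k. \<epsilon> *\<^sub>R z k) \<in> lp_ball p (\<epsilon> * 1)"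
    using \<epsilon> z(1) by (intro lp_ball_scale[OF p]) auto
  ultimately show "\<exists>z\<in>lp_ball p \<epsilon>. \<exists>N. \<forall>n\<ge>N. x n \<in> pr_conv smul r z"
    by (metis mult.right_neutral)
qed

lemma (in banach_over) norm_pr_conv_le:
  assumes pr: "1 \<le> p" "p < \<infinity>" "1 \<le> r" "r \<le> conj_index p" and z: "z \<in> lp_ball p C" "0 < C"
    and v: "v \<in> pr_conv smul r z"
  shows "norm v \<le> 2 * C"
proof -
  obtain a where a: "a \<in> lp_ball r 1" "(\<lambda>k. smul (a k) (z k)) sums v"
    using v by (auto simp: pr_conv_def)
  have "norm (\<Sum>k. smul (a k) (z k)) \<le> 2 * 1 * C"
    using z lp_ball_section_norm[OF pr(3) a(1)] by (intro norm_sums_le(2)[OF pr]) auto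
  then show ?thesis using sums_unique[OF a(2)] by simp
qed

lemma unit_vector_in_lp_ball:
  assumes "1 \<le> r" shows "(\<lambda>k. if k = i then 1 else 0 :: 'k::real_normed_field) \<in> lp_ball r 1"
proof (rule lp_ballI[OF assms])
  show "section_norm r N (\<lambda>k. if k = i then 1 else 0 :: 'k) \<le> 1" for N
    using section_norm_single[OF assms, of N i "1 :: 'k"] by simp
  show "(\<lambda>k. if k = i then 1 else 0 :: 'k) \<longlonglongrightarrow> 0"
    by (rule tendsto_eventually) (auto simp: eventually_sequentially intro!: exI[of _ "Suc i"])
qed

lemma shift_in_lp_ball:
  assumes r: "1 \<le> r" and a: "a \<in> lp_ball r C"
  shows "(\<lambda>k. if k < m then 0 else a (k - m)) \<in> lp_ball r C"
proof (rule lp_ballI[OF r])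
  let ?b = "\<lambda>k. if k < m then 0 else a (k - m)"
  have C: "0 \<le> C" using lp_ball_section_norm[OF r a, of 0] section_norm_nonneg[of r 0 a] by linarith
  show "section_norm r N ?b \<le> C" for N
  proof (cases "N < m \<or> r = \<infinity>")
    case True
    then show ?thesis using C lp_ball_section_norm[OF r a, of "N - m"] by (auto simp: section_norm_def)
  next
    case False
    have "(\<Sum>k<N. norm (?b k) powr real_of_ereal r) = (\<Sum>k\<in>{m..<N}. norm (a (k - m)) powr real_of_ereal r)"
      by (rule sum.mono_neutral_cong_right) auto
    also have "\<dots> = (\<Sum>k<N - m. norm (a k) powr real_of_ereal r)"
      using False by (intro sum.reindex_bij_witness[of _ "\<lambda>k. k + m" "\<lambda>k. k - m"]) auto
    finally have "section_norm r N ?b = section_norm r (N - m) a"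
      using False by (simp add: section_norm_def)
    then show ?thesis using lp_ball_section_norm[OF r a] by simp
  qed
  show "?b \<longlonglongrightarrow> 0" if "r = \<infinity>"
  proof -
    have "a \<longlonglongrightarrow> 0" using a that by (simp add: lp_ball_def lp_def)
    then have "(\<lambda>k. ?b (k + m)) \<longlonglongrightarrow> 0" by simp
    then show ?thesis by (rule LIMSEQ_offset)
  qed
qed

lemma lp_finite_change:
  assumes "p < \<infinity>" "z \<in> lp p" "1 \<le> p" and "\<And>k. z' (k + m) = z k"
  shows "z' \<in> lp p"
  using assms summable_iff_shift[of "\<lambda>k. norm (z' k) powr real_of_ereal p" m] by (simp add: lp_def)

text \<open>The finitely many terms outside the hull of \<^term>\<open>z\<close> are prepended to \<^term>\<open>z\<close>.\<close>

lemma (in banach_over) pr_null_imp_null_rel_pr_compact: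
  assumes pr: "1 \<le> p" "p < \<infinity>" "1 \<le> r" "r \<le> conj_index p" and x: "pr_null smul p r x"
  shows "x \<longlonglongrightarrow> 0" and "rel_pr_compact smul p r (range x)"
proof -
  show "x \<longlonglongrightarrow> 0"
  proof (rule LIMSEQ_I)
    fix e :: real
    assume "0 < e"
    then obtain z N where z: "z \<in> lp_ball p (e / 3)" and N: "\<forall>n\<ge>N. x n \<in> pr_conv smul r z"
      using x unfolding pr_null_def by (metis zero_less_divide_iff zero_less_numeral)
    have "norm (x n) \<le> 2 * (e / 3)" if "N \<le> n" for n
      using N that \<open>0 < e\<close> by (intro norm_pr_conv_le[OF pr z]) auto
    with \<open>0 < e\<close> show "\<exists>no. \<forall>n\<ge>no. norm (x n - 0) < e" by fastforce
  qed
  \<comment> \<open>For compactness the single choice \<epsilon> = 1 suffices.\<close>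
  obtain z m where z: "z \<in> lp_ball p 1" and m: "\<forall>n\<ge>m. x n \<in> pr_conv smul r z"
    using x unfolding pr_null_def by (metis zero_less_one)
  define z' where "z' k = (if k < m then x k else z (k - m))" for k
  have "z' \<in> lp p"
    using z pr by (intro lp_finite_change[of p z z' m]) (auto simp: z'_def lp_ball_def)
  moreover have "x n \<in> pr_conv smul r z'" for n
  proof (cases "n < m")
    case True
    have "(\<lambda>k. smul (if k = n then 1 else 0) (z' k)) = (\<lambda>k. if k = n then x n else 0)"
      using True by (auto simp: z'_def)
    then have "(\<lambda>k. smul (if k = n then 1 else 0) (z' k)) sums x n"
      using sums_single[of n "\<lambda>_. x n"] by simp
    then show ?thesis
      unfolding pr_conv_def
      by (intro CollectI bexI[of _ "\<lambda>k. if k = n then 1 else 0"] unit_vector_in_lp_ball pr(3))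
  next
    case False
    then have "x n \<in> pr_conv smul r z" using m by simp
    then obtain a where a: "a \<in> lp_ball r 1" "(\<lambda>k. smul (a k) (z k)) sums x n"
      by (auto simp: pr_conv_def)
    define a' where "a' k = (if k < m then 0 else a (k - m))" for k
    have "(\<lambda>k. smul (a' (k + m)) (z' (k + m))) sums x n" using a(2) by (simp add: a'_def z'_def)
    then have "(\<lambda>k. smul (a' k) (z' k)) sums (x n + (\<Sum>k<m. smul (a' k) (z' k)))"
      by (subst (asm) sums_iff_shift)
    moreover have "(\<Sum>k<m. smul (a' k) (z' k)) = 0" by (simp add: a'_def)
    moreover have "a' \<in> lp_ball r 1" using shift_in_lp_ball[OF pr(3) a(1)] by (simp add: a'_def[abs_def])
    ultimately show ?thesis unfolding pr_conv_def by auto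
  qed
  ultimately show "rel_pr_compact smul p r (range x)" unfolding rel_pr_compact_def by auto
qed

section \<open>Banach spaces with a carrier\<close>

lemma cring_scalar_ring: "cring (scalar_ring :: 'k::field ring)"
  unfolding scalar_ring_def
  by (rule cringI; (intro abelian_groupI comm_monoidI)?)
    (auto simp: algebra_simps intro: exI[of _ "- _"])

context carrier_normed_space
begin

lemma uminus_eq_smult:
  assumes "u \<in> carrier Y" shows "\<ominus> u = (- 1) \<odot> u"
  using smult_l_minus[of 1 u] smult_one[OF assms] assms R.minus_equality[of "- 1" 1]
  by (simp add: scalar_ring_def)

lemma smult_in_carrier [simp]: "u \<in> carrier Y \<Longrightarrow> c \<odot> u \<in> carrier Y"
  using smult_closed[of c u] by (simp add: scalar_ring_def)

lemma smult_smult: "u \<in> carrier Y \<Longrightarrow> c \<odot> (d \<odot> u) = (c * d) \<odot> u"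
  using smult_assoc1[of c d u] by (simp add: scalar_ring_def)

lemma one_smult: "u \<in> carrier Y \<Longrightarrow> 1 \<odot> u = u"
  using smult_one[of u] by (simp add: scalar_ring_def)

lemma zero_in_unit_ball: "\<zero> \<in> unit_ball Y"
  using vnorm_eq_0[OF M.zero_closed] by (simp add: unit_ball_def)

text \<open>Scaling by an upper bound \<open>M\<close> of the norm covers \<open>u = 0\<close> and
  lets one factor serve a whole bounded set.\<close>

lemma unit_ball_scale:
  assumes "u \<in> carrier Y" "vnorm Y u \<le> M" "0 < M"
  obtains v where "v \<in> unit_ball Y" "u = of_real M \<odot> v"
proof
  have "norm (of_real (inverse M) :: 'k) = inverse M"
    using assms(3) by (simp del: of_real_inverse)
  then have "vnorm Y (of_real (inverse M) \<odot> u) = inverse M * vnorm Y u"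
    using assms(1) by (simp add: vnorm_smult del: of_real_inverse)
  also have "\<dots> \<le> 1" using assms(2,3) by (simp add: field_simps)
  finally show "of_real (inverse M) \<odot> u \<in> unit_ball Y"
    using assms(1) by (simp add: unit_ball_def)
  have "(of_real M * of_real (inverse M) :: 'k) = 1"
    using assms(3) by (simp flip: of_real_mult)
  then show "u = of_real M \<odot> (of_real (inverse M) \<odot> u)"
    using assms(1) by (simp add: smult_smult one_smult del: of_real_inverse)
qed

lemma linear_op_zero:
  assumes "linear_op smul Y T" shows "T \<zero> = 0"
proof -
  have "T (\<zero> \<oplus> \<zero>) = T \<zero> + T \<zero>"
    using assms M.zero_closed unfolding linear_op_def by blast
  then show ?thesis by simp
qed

end

lemma (in banach_over) linear_op_le_of_unit_ball:
  assumes Y: "carrier_normed_space Y" and T: "linear_op smul Y T"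
    and C: "\<And>u. u \<in> unit_ball Y \<Longrightarrow> norm (T u) \<le> C" and u: "u \<in> carrier Y"
  shows "norm (T u) \<le> C * vnorm Y u"
proof -
  interpret Y: carrier_normed_space Y by (rule Y)
  show ?thesis
  proof (cases "vnorm Y u = 0")
    case True
    then have "u = \<zero>\<^bsub>Y\<^esub>" using Y.vnorm_eq_0[OF u] by blast
    then have "T u = 0" using Y.linear_op_zero[OF T] by blast
    then show ?thesis using True by simp
  next
    case False
    define m where "m = vnorm Y u"
    have m: "0 < m" "vnorm Y u \<le> m" using False Y.vnorm_nonneg[OF u] by (simp_all add: m_def)
    obtain v where v: "v \<in> unit_ball Y" "u = of_real m \<odot>\<^bsub>Y\<^esub> v"
      using Y.unit_ball_scale[OF u m(2,1)] by blast
    have "v \<in> carrier Y" using v(1) by (simp add: unit_ball_def)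
    then have "T (of_real m \<odot>\<^bsub>Y\<^esub> v) = smul (of_real m) (T v)"
      using T unfolding linear_op_def by blast
    then have "norm (T u) = m * norm (T v)" unfolding v(2)[symmetric] using m by (simp add: norm_smul)
    also have "\<dots> \<le> m * C" using C[OF v(1)] m by (intro mult_left_mono) auto
    finally show ?thesis by (simp add: m_def mult.commute)
  qed
qed

text \<open>Stated for seminorms, to be applied to the section norms of the coefficients of a
  nuclear operator. The sets \<open>U m\<close> are open and, by pointwise boundedness, have empty
  intersection; by Baire's theorem one of them is not dense, so all \<open>q n\<close> are bounded
  by \<open>m\<close> on some ball.\<close>

lemma (in carrier_banach_space) uniform_boundedness:
  fixes q :: "nat \<Rightarrow> 'a \<Rightarrow> real"
  assumes add: "\<And>n u v. u \<in> carrier Y \<Longrightarrow> v \<in> carrier Y \<Longrightarrow> q n (u \<oplus> v) \<le> q n u + q n v"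
    and smult: "\<And>n c u. u \<in> carrier Y \<Longrightarrow> q n (c \<odot> u) = norm c * q n u"
    and bounded: "\<And>n. \<exists>C. \<forall>u\<in>carrier Y. q n u \<le> C * vnorm Y u"
    and pointwise: "\<And>u. u \<in> carrier Y \<Longrightarrow> bdd_above (range (\<lambda>n. q n u))"
  obtains C where "\<And>n u. u \<in> unit_ball Y \<Longrightarrow> q n u \<le> C"
proof -
  interpret Metric_space "carrier Y" "vdist Y" by (rule Metric_space_vdist)
  define U where "U m = {u \<in> carrier Y. \<exists>n. real m < q n u}" for m :: nat
  have open_U: "openin mtopology (U m)" for m
    unfolding openin_mtopology
  proof (intro conjI allI impI)
    show "U m \<subseteq> carrier Y" by (auto simp: U_def)
    fix u
    assume "u \<in> U m"
    then obtain n where u: "u \<in> carrier Y" and n: "real m < q n u" by (auto simp: U_def)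
    obtain C where C: "\<And>u. u \<in> carrier Y \<Longrightarrow> q n u \<le> C * vnorm Y u" using bounded by blast
    \<comment> \<open>On this radius \<open>q n\<close> varies by less than its excess over
      \<open>m\<close>.\<close>
    define e where "e = (q n u - m) / (\<bar>C\<bar> + 1)"
    have e: "0 < e" using n by (simp add: e_def)
    have "v \<in> U m" if "v \<in> mball u e" for v
    proof -
      have v: "v \<in> carrier Y" and d: "vnorm Y (u \<ominus> v) < e" using that by (auto simp: vdist_def)
      have uv: "u \<ominus> v \<in> carrier Y" using u v by simp
      have "u = v \<oplus> (u \<ominus> v)" using u v by (simp add: M.minus_eq M.a_lcomm M.r_neg)
      then have "q n u \<le> q n v + q n (u \<ominus> v)" using add[OF v uv] by simp
      also have "q n (u \<ominus> v) \<le> (\<bar>C\<bar> + 1) * vnorm Y (u \<ominus> v)"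
        using C[OF uv] vnorm_nonneg[OF uv] by (smt (verit) mult_right_mono)
      also have "\<dots> < (\<bar>C\<bar> + 1) * e" using d by (intro mult_strict_left_mono) auto
      also have "\<dots> = q n u - m" by (simp add: e_def)
      finally have "real m < q n v" by simp
      then show ?thesis using v by (auto simp: U_def)
    qed
    then show "\<exists>e>0. mball u e \<subseteq> U m" using e by blast
  qed
  have "\<exists>m. mtopology closure_of U m \<noteq> carrier Y"
  proof (rule ccontr)
    assume "\<not> ?thesis"
    then have "mtopology closure_of (\<Inter> (range U)) = carrier Y"
      using open_U by (intro metric_Baire_category complete) auto
    then have "\<Inter> (range U) \<noteq> {}" by (metis M.zero_closed closure_of_empty empty_iff)
    then obtain u where u: "\<And>m. u \<in> U m" by auto
    then have "u \<in> carrier Y" by (simp add: U_def)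
    then obtain B where "\<And>n. q n u \<le> B" using pointwise by (fastforce simp: bdd_above_def)
    moreover obtain m :: nat where "B < m" using reals_Archimedean2 by blast
    ultimately show False using u[of m] by (force simp: U_def dest: less_le_trans)
  qed
  then obtain m where "mtopology closure_of U m \<noteq> carrier Y" by blast
  then obtain y e where y: "y \<in> carrier Y" and e: "0 < e" and ball: "\<And>v. v \<in> U m \<Longrightarrow> v \<notin> mball y e"
    unfolding metric_closure_of by blast
  have in_ball: "q n v \<le> m" if "v \<in> mball y e" for n v
    using ball[of v] that by (force simp: U_def not_less[symmetric])
  \<comment> \<open>The ball is moved to the origin: with h = (e / 2) u, both
    \<open>y \<oplus> h\<close> and \<open>y\<close> lie in it, so \<open>q n h\<close> is at most 2
    m.\<close>
  have "q n u \<le> 4 * m / e" if u: "u \<in> unit_ball Y" for n u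
  proof -
    have uc: "u \<in> carrier Y" "vnorm Y u \<le> 1" using u by (auto simp: unit_ball_def)
    define h where "h = of_real (e / 2) \<odot> u"
    have h: "h \<in> carrier Y" using uc by (simp add: h_def)
    have "(y \<oplus> h) \<ominus> y = \<ominus> y \<oplus> (y \<oplus> h)"
      unfolding M.minus_eq using y h by (intro M.a_comm) auto
    then have diff: "(y \<oplus> h) \<ominus> y = h" using y h by (simp add: M.r_neg1)
    have "vnorm Y h < e" using uc e by (simp add: h_def vnorm_smult norm_divide)
    then have "vdist Y (y \<oplus> h) y < e" using y h diff by (simp add: vdist_def)
    then have "y \<oplus> h \<in> mball y e" using y h by (simp add: commute)
    then have "q n (y \<oplus> h) \<le> m" by (rule in_ball)
    moreover have "q n y \<le> m" using y e by (intro in_ball) simp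
    moreover have "q n (\<ominus> y) = q n y" using smult[OF y] by (simp add: uminus_eq_smult[OF y])
    moreover have "q n h \<le> q n (y \<oplus> h) + q n (\<ominus> y)"
      using add[of "y \<oplus> h" "\<ominus> y" n] y h diff by (simp add: M.minus_eq)
    moreover have "q n h = e / 2 * q n u" using smult[OF uc(1), of n "of_real (e / 2)"] e by (simp add: h_def)
    ultimately have "e / 2 * q n u \<le> 2 * m" by linarith
    then show ?thesis using e by (simp add: field_simps)
  qed
  then show thesis using that by blast
qed

section \<open>The space of sequences with bounded sections\<close>

text \<open>For \<^term>\<open>r = \<infinity>\<close> this is the space of bounded sequences, not the space \<^term>\<open>lp \<infinity>\<close>
  of null sequences. The injection \<^term>\<open>\<iota>\<close> moves it into the universe type.\<close>

definition section_space ::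
    "((nat \<Rightarrow> 'k) \<Rightarrow> 'y) \<Rightarrow> ereal \<Rightarrow> ('k::{real_normed_field,euclidean_space}, 'y) nspace" where
  "section_space \<iota> r =
     \<lparr>carrier = \<iota> ` {a. bdd_above (range (\<lambda>N. section_norm r N a))},
      monoid.mult = undefined, one = undefined,
      zero = \<iota> (\<lambda>k. 0), add = (\<lambda>u v. \<iota> (\<lambda>k. inv_into UNIV \<iota> u k + inv_into UNIV \<iota> v k)),
      smult = (\<lambda>c u. \<iota> (\<lambda>k. c * inv_into UNIV \<iota> u k)),
      vnorm = (\<lambda>u. SUP N. section_norm r N (inv_into UNIV \<iota> u))\<rparr>"

locale embedded_section_space =
  fixes \<iota> :: "(nat \<Rightarrow> 'k::{real_normed_field,euclidean_space}) \<Rightarrow> 'y" and r :: ereal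
  assumes inj: "inj \<iota>" and r: "1 \<le> r"
begin

abbreviation Y where "Y \<equiv> section_space \<iota> r"

abbreviation bdd :: "(nat \<Rightarrow> 'k) \<Rightarrow> bool" where "bdd a \<equiv> bdd_above (range (\<lambda>N. section_norm r N a))"

lemma inv_\<iota> [simp]: "inv_into UNIV \<iota> (\<iota> a) = a"
  using inj by simp

lemma \<iota>_eq_iff [simp]: "\<iota> a = \<iota> b \<longleftrightarrow> a = b"
  using inj by (auto dest: injD)

lemma in_carrier [simp]: "\<iota> a \<in> carrier Y \<longleftrightarrow> bdd a"
  by (auto simp: section_space_def)

lemma carrierE:
  assumes "u \<in> carrier Y" obtains a where "u = \<iota> a" "bdd a"
  using assms by (auto simp: section_space_def)

lemma bddI: "(\<And>N. section_norm r N a \<le> C) \<Longrightarrow> bdd a"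
  by (auto simp: bdd_above_def)

lemma bdd_zero [simp]: "bdd (\<lambda>k. 0)"
  by (rule bddI[of _ 0]) simp

lemma add_\<iota> [simp]: "\<iota> a \<oplus>\<^bsub>Y\<^esub> \<iota> b = \<iota> (\<lambda>k. a k + b k)"
  and smult_\<iota> [simp]: "c \<odot>\<^bsub>Y\<^esub> \<iota> a = \<iota> (\<lambda>k. c * a k)"
  and zero_\<iota>: "\<zero>\<^bsub>Y\<^esub> = \<iota> (\<lambda>k. 0)"
  by (simp_all add: section_space_def)

lemma section_norm_le_vnorm: "bdd a \<Longrightarrow> section_norm r N a \<le> vnorm Y (\<iota> a)"
  unfolding section_space_def by (auto intro: cSUP_upper)

lemma vnorm_le: "(\<And>N. section_norm r N a \<le> C) \<Longrightarrow> vnorm Y (\<iota> a) \<le> C"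
  by (simp add: section_space_def cSUP_least)

lemma vnorm_nonneg': "bdd a \<Longrightarrow> 0 \<le> vnorm Y (\<iota> a)"
  using section_norm_le_vnorm[of a 0] section_norm_nonneg[of r 0 a] by linarith

lemma section_norm_add_le:
  assumes "bdd a" "bdd b"
  shows "section_norm r N (\<lambda>k. a k + b k) \<le> vnorm Y (\<iota> a) + vnorm Y (\<iota> b)"
  using section_norm_add[OF r, of N a b] section_norm_le_vnorm[of a N] section_norm_le_vnorm[of b N] assms
  by linarith

lemma section_norm_mult_le:
  assumes "bdd a" shows "section_norm r N (\<lambda>k. c * a k) \<le> norm c * vnorm Y (\<iota> a)"
  unfolding section_norm_mult[OF r] using assms by (intro mult_left_mono section_norm_le_vnorm) auto

lemma bdd_add:
  assumes "bdd a" "bdd b" shows "bdd (\<lambda>k. a k + b k)"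
  using section_norm_add_le[OF assms] by (rule bddI)

lemma bdd_mult:
  assumes "bdd a" shows "bdd (\<lambda>k. c * a k)"
  using section_norm_mult_le[OF assms] by (rule bddI)

lemma bdd_uminus: "bdd a \<Longrightarrow> bdd (\<lambda>k. - a k)"
  by simp

lemma abelian_group: "abelian_group Y"
proof (rule abelian_groupI)
  show "\<exists>v\<in>carrier Y. v \<oplus>\<^bsub>Y\<^esub> u = \<zero>\<^bsub>Y\<^esub>" if u: "u \<in> carrier Y" for u
  proof -
    obtain a where "u = \<iota> a" "bdd a" using u by (rule carrierE)
    then show ?thesis by (intro bexI[of _ "\<iota> (\<lambda>k. - a k)"]) (auto simp: zero_\<iota>)
  qed
qed (auto elim!: carrierE simp: zero_\<iota> bdd_add add_ac)

lemma module: "Module.module scalar_ring Y"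
  by (rule moduleI[OF cring_scalar_ring abelian_group])
    (auto elim!: carrierE simp: scalar_ring_def bdd_mult algebra_simps)

lemma carrier_normed_space: "carrier_normed_space Y"
proof (intro carrier_normed_space.intro module carrier_normed_space_axioms.intro)
  fix u v c
  assume u: "u \<in> carrier Y"
  then obtain a where a: "u = \<iota> a" "bdd a" by (rule carrierE)
  show "vnorm Y u = 0 \<longleftrightarrow> u = \<zero>\<^bsub>Y\<^esub>"
  proof
    assume "vnorm Y u = 0"
    then have "section_norm r N a \<le> 0" for N using section_norm_le_vnorm[OF a(2), of N] a(1) by simp
    then have "norm (a k) \<le> 0" for k by (rule norm_le_section_norm[OF r])
    then show "u = \<zero>\<^bsub>Y\<^esub>" using a(1) by (auto simp: zero_\<iota>)
  next
    assume "u = \<zero>\<^bsub>Y\<^esub>"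
    then show "vnorm Y u = 0" by (simp add: zero_\<iota> section_space_def)
  qed
  show "vnorm Y (c \<odot>\<^bsub>Y\<^esub> u) = norm c * vnorm Y u"
  proof (rule antisym)
    show "vnorm Y (c \<odot>\<^bsub>Y\<^esub> u) \<le> norm c * vnorm Y u"
      unfolding a(1) smult_\<iota> using a(2) by (intro vnorm_le section_norm_mult_le)
    show "norm c * vnorm Y u \<le> vnorm Y (c \<odot>\<^bsub>Y\<^esub> u)"
    proof (cases "c = 0")
      case False
      have "section_norm r N a \<le> vnorm Y (c \<odot>\<^bsub>Y\<^esub> u) / norm c" for N
        using section_norm_le_vnorm[OF bdd_mult[OF a(2), of c], of N] False
        by (simp add: a(1) section_norm_mult[OF r] field_simps)
      then have "vnorm Y u \<le> vnorm Y (c \<odot>\<^bsub>Y\<^esub> u) / norm c" unfolding a(1) by (rule vnorm_le)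
      then show ?thesis using False by (simp add: field_simps)
    qed (use vnorm_nonneg'[OF bdd_mult[OF a(2), of 0]] a(1) in simp)
  qed
  assume "v \<in> carrier Y"
  then obtain b where b: "v = \<iota> b" "bdd b" by (rule carrierE)
  show "vnorm Y (u \<oplus>\<^bsub>Y\<^esub> v) \<le> vnorm Y u + vnorm Y v"
    unfolding a(1) b(1) add_\<iota> using a(2) b(2) by (intro vnorm_le section_norm_add_le)
qed

sublocale carrier_normed_space Y by (rule carrier_normed_space)

lemma vdist_\<iota>:
  assumes "bdd a" "bdd b" shows "vdist Y (\<iota> a) (\<iota> b) = vnorm Y (\<iota> (\<lambda>k. a k - b k))"
proof -
  have "\<ominus>\<^bsub>Y\<^esub> \<iota> b = \<iota> (\<lambda>k. - b k)"
    using assms(2) by (simp add: uminus_eq_smult)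
  then show ?thesis using assms by (simp add: vdist_def M.minus_eq)
qed

text \<open>A Cauchy sequence converges in each coordinate, and section norms are continuous for
  this convergence. Non-strict bounds that hold for all sections at once therefore pass to the
  limit.\<close>

lemma carrier_banach_space: "carrier_banach_space Y"
proof (intro carrier_banach_space.intro carrier_normed_space carrier_banach_space_axioms.intro)
  interpret Metric_space "carrier Y" "vdist Y" by (rule Metric_space_vdist)
  show "mcomplete"
    unfolding mcomplete_def
  proof (intro allI impI)
    fix \<sigma>
    assume "MCauchy \<sigma>"
    then have carr: "\<And>n. \<sigma> n \<in> carrier Y"
      and cauchy: "\<And>\<epsilon>. 0 < \<epsilon> \<Longrightarrow> \<exists>N. \<forall>m n. N \<le> m \<longrightarrow> N \<le> n \<longrightarrow> vdist Y (\<sigma> m) (\<sigma> n) < \<epsilon>"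
      by (auto simp: MCauchy_def)
    define s where "s n = inv_into UNIV \<iota> (\<sigma> n)" for n
    have s: "\<sigma> n = \<iota> (s n)" "bdd (s n)" for n
      using carr[of n] by (auto simp: s_def elim!: carrierE)
    have bdd_diff: "bdd (\<lambda>k. s m k - s n k)" for m n
      using bdd_add[OF s(2)[of m] bdd_uminus[OF s(2)[of n]]] by simp
    have close: "\<exists>M. \<forall>m n. M \<le> m \<longrightarrow> M \<le> n \<longrightarrow> (\<forall>N. section_norm r N (\<lambda>k. s m k - s n k) \<le> \<epsilon>)"
      if "0 < \<epsilon>" for \<epsilon>
    proof -
      obtain M where M: "\<And>m n. M \<le> m \<Longrightarrow> M \<le> n \<Longrightarrow> vdist Y (\<sigma> m) (\<sigma> n) < \<epsilon>"
        using cauchy[OF \<open>0 < \<epsilon>\<close>] by blast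
      have "section_norm r N (\<lambda>k. s m k - s n k) \<le> \<epsilon>" if "M \<le> m" "M \<le> n" for m n N
        using section_norm_le_vnorm[OF bdd_diff[of m n], of N] M[OF that]
        by (simp add: s vdist_\<iota>)
      then show ?thesis by blast
    qed
    have "Cauchy (\<lambda>n. s n k)" for k
    proof (rule CauchyI)
      fix e :: real
      assume "0 < e"
      then obtain M where "\<And>m n N. M \<le> m \<Longrightarrow> M \<le> n \<Longrightarrow> section_norm r N (\<lambda>k. s m k - s n k) \<le> e / 2"
        using close[of "e / 2"] by auto
      then have le: "norm (s m k - s n k) \<le> e / 2" if "M \<le> m" "M \<le> n" for m n
        using norm_le_section_norm[OF r, of "\<lambda>k. s m k - s n k"] that by blast
      have "e / 2 < e" using \<open>0 < e\<close> by simp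
      then show "\<exists>M. \<forall>m\<ge>M. \<forall>n\<ge>M. norm (s m k - s n k) < e"
        using le_less_trans[OF le] by blast
    qed
    then have "convergent (\<lambda>n. s n k)" for k by (rule Cauchy_convergent)
    then have "\<forall>k. \<exists>l. (\<lambda>n. s n k) \<longlonglongrightarrow> l" by (simp add: convergent_def)
    from choice[OF this] obtain c where c: "\<And>k. (\<lambda>n. s n k) \<longlonglongrightarrow> c k" by blast
    have limit: "\<exists>M. \<forall>m\<ge>M. \<forall>N. section_norm r N (\<lambda>k. s m k - c k) \<le> \<epsilon>" if "0 < \<epsilon>" for \<epsilon>
    proof -
      obtain M where M: "\<And>m n N. M \<le> m \<Longrightarrow> M \<le> n \<Longrightarrow> section_norm r N (\<lambda>k. s m k - s n k) \<le> \<epsilon>"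
        using close[OF \<open>0 < \<epsilon>\<close>] by blast
      have "section_norm r N (\<lambda>k. s m k - c k) \<le> \<epsilon>" if m: "M \<le> m" for m N
      proof (rule LIMSEQ_le_const2)
        show "(\<lambda>n. section_norm r N (\<lambda>k. s m k - s n k)) \<longlonglongrightarrow> section_norm r N (\<lambda>k. s m k - c k)"
          by (intro tendsto_section_norm r tendsto_intros c)
        show "\<exists>K. \<forall>n\<ge>K. section_norm r N (\<lambda>k. s m k - s n k) \<le> \<epsilon>" using M[OF m] by blast
      qed
      then show ?thesis by blast
    qed
    obtain M where "\<And>N. section_norm r N (\<lambda>k. s M k - c k) \<le> 1"
      using limit[of 1] by auto
    then have "bdd (\<lambda>k. s M k - c k)" by (rule bddI)
    from bdd_add[OF s(2)[of M] bdd_uminus[OF this]] have c_bdd: "bdd c" by simp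
    have "limitin mtopology \<sigma> (\<iota> c) sequentially"
      unfolding limit_metric_sequentially
    proof (intro conjI allI impI)
      show "\<iota> c \<in> carrier Y" using c_bdd by simp
      fix \<epsilon> :: real
      assume "0 < \<epsilon>"
      then obtain M where "\<And>m N. M \<le> m \<Longrightarrow> section_norm r N (\<lambda>k. s m k - c k) \<le> \<epsilon> / 2"
        using limit[of "\<epsilon> / 2"] by auto
      then have "vnorm Y (\<iota> (\<lambda>k. s m k - c k)) \<le> \<epsilon> / 2" if "M \<le> m" for m
        using that by (intro vnorm_le) auto
      then have "vdist Y (\<sigma> m) (\<iota> c) < \<epsilon>" if "M \<le> m" for m
        using that \<open>0 < \<epsilon>\<close> s c_bdd by (fastforce simp: vdist_\<iota>)
      then show "\<exists>M. \<forall>m\<ge>M. \<sigma> m \<in> carrier Y \<and> vdist Y (\<sigma> m) (\<iota> c) < \<epsilon>"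
        using carr by blast
    qed
    then show "\<exists>x. limitin mtopology \<sigma> x sequentially" by blast
  qed
qed

end

section \<open>The dual space and the two operator ideals\<close>

lemma banach_over_mult: "banach_over ((*) :: 'k::{real_normed_field,euclidean_space} \<Rightarrow> 'k \<Rightarrow> 'k)"
  by unfold_locales (simp_all add: algebra_simps norm_mult scaleR_conv_of_real)

context carrier_normed_space
begin

lemma norm_le_dual_norm:
  assumes f: "f \<in> carrier (dual Y)" and u: "u \<in> unit_ball Y"
  shows "norm (f u) \<le> vnorm (dual Y) f"
proof -
  obtain C where C: "\<And>u. u \<in> carrier Y \<Longrightarrow> norm (f u) \<le> C * vnorm Y u"
    using f by (auto simp: dual_def bounded_op_def)
  have "norm (f u) \<le> \<bar>C\<bar>" if "u \<in> unit_ball Y" for u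
  proof -
    have u: "u \<in> carrier Y" "vnorm Y u \<le> 1" using that by (auto simp: unit_ball_def)
    have "C * vnorm Y u \<le> \<bar>C\<bar> * 1"
      using u vnorm_nonneg[OF u(1)] by (intro mult_mono) auto
    then show ?thesis using C[OF u(1)] by simp
  qed
  then have "bdd_above ((\<lambda>u. norm (f u)) ` unit_ball Y)" by (rule bdd_aboveI2)
  then show ?thesis using u by (auto simp: dual_def intro: cSUP_upper)
qed

lemma dual_norm_le:
  assumes "\<And>u. u \<in> unit_ball Y \<Longrightarrow> norm (f u) \<le> C"
  shows "vnorm (dual Y) f \<le> C"
  using assms zero_in_unit_ball by (auto simp: dual_def intro!: cSUP_least)

lemma dual_norm_nonneg: "f \<in> carrier (dual Y) \<Longrightarrow> 0 \<le> vnorm (dual Y) f"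
  using norm_le_dual_norm[OF _ zero_in_unit_ball] norm_ge_zero order_trans by blast

text \<open>Weak summability in \<open>dual Y\<close> is tested by the bidual; through evaluations
  it yields information on the scalars \<open>a n y\<close>.\<close>

lemma evaluation_in_bidual:
  assumes y: "y \<in> carrier Y"
  shows "(\<lambda>f. if f \<in> carrier (dual Y) then f y else 0) \<in> carrier (dual (dual Y))"
proof -
  \<comment> \<open>The evaluation is cut off outside the dual, so its linearity requires the dual
    to be closed under the operations.\<close>
  have closed: "(\<lambda>u. f u + g u) \<in> carrier (dual Y)" if f: "f \<in> carrier (dual Y)" and g: "g \<in> carrier (dual Y)" for f g
  proof -
    obtain C where C: "\<And>u. u \<in> carrier Y \<Longrightarrow> norm (f u) \<le> C * vnorm Y u"
      using f by (auto simp: dual_def bounded_op_def)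
    obtain D where D: "\<And>u. u \<in> carrier Y \<Longrightarrow> norm (g u) \<le> D * vnorm Y u"
      using g by (auto simp: dual_def bounded_op_def)
    have "norm (f u + g u) \<le> (C + D) * vnorm Y u" if "u \<in> carrier Y" for u
      using norm_triangle_ineq[of "f u" "g u"] C[OF that] D[OF that] by (simp add: distrib_right)
    moreover have "linear_op (*) Y (\<lambda>u. f u + g u)"
      using f g by (simp add: dual_def bounded_op_def linear_op_def algebra_simps)
    ultimately show ?thesis
      using f g by (auto simp: dual_def bounded_op_def)
  qed
  have closed': "(\<lambda>u. c * f u) \<in> carrier (dual Y)" if f: "f \<in> carrier (dual Y)" for c f
  proof -
    obtain C where "\<And>u. u \<in> carrier Y \<Longrightarrow> norm (f u) \<le> C * vnorm Y u"
      using f by (auto simp: dual_def bounded_op_def)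
    then have "norm (c * f u) \<le> (norm c * C) * vnorm Y u" if "u \<in> carrier Y" for u
      using that by (simp add: norm_mult mult.assoc mult_left_mono)
    moreover have "linear_op (*) Y (\<lambda>u. c * f u)"
      using f by (simp add: dual_def bounded_op_def linear_op_def algebra_simps)
    ultimately show ?thesis
      using f by (auto simp: dual_def bounded_op_def)
  qed
  have "norm (f y) \<le> vnorm Y y * vnorm (dual Y) f" if f: "f \<in> carrier (dual Y)" for f
  proof -
    have "linear_op (*) Y f" using f by (simp add: dual_def bounded_op_def)
    from banach_over.linear_op_le_of_unit_ball[OF banach_over_mult carrier_normed_space_axioms this
        norm_le_dual_norm[OF f] y]
    show ?thesis by (simp add: mult.commute)
  qed
  moreover have "add (dual Y) f g = (\<lambda>u. f u + g u)" "smult (dual Y) c f = (\<lambda>u. c * f u)" for f g c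
    by (simp_all add: dual_def)
  ultimately have "bounded_op (*) (dual Y) (\<lambda>f. if f \<in> carrier (dual Y) then f y else 0)"
    using closed closed' unfolding bounded_op_def linear_op_def by auto
  then show ?thesis by (simp add: dual_def[of "dual Y"])
qed

lemma weakly_summable_apply:
  assumes a: "weakly_summable (dual Y) r a" and "r \<noteq> \<infinity>" and y: "y \<in> carrier Y"
  shows "(\<lambda>n. a n y) \<in> lp r"
proof -
  have "(\<lambda>n. if a n \<in> carrier (dual Y) then a n y else 0) \<in> lp r"
    using a \<open>r \<noteq> \<infinity>\<close> evaluation_in_bidual[OF y] by (auto simp: weakly_summable_def)
  moreover have "a n \<in> carrier (dual Y)" for n using a by (auto simp: weakly_summable_def)
  ultimately show ?thesis by simp
qed

lemma vdist_zero:
  assumes "u \<in> carrier Y" shows "vdist Y u \<zero> = vnorm Y u"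
proof -
  have zero: "\<ominus> \<zero> = \<zero>" by (rule M.minus_equality) auto
  show ?thesis using assms by (simp add: vdist_def M.minus_eq zero)
qed

text \<open>A convergent sequence together with its limit is compact, and the closure of the range
  is a closed subset of it.\<close>

lemma null_in_imp_relatively_compact_in:
  assumes y: "null_in Y y"
  shows "relatively_compact_in Y (range y)"
proof -
  interpret Metric_space "carrier Y" "vdist Y" by (rule Metric_space_vdist)
  have carr: "y n \<in> carrier Y" for n using y by (auto simp: null_in_def)
  have "limitin mtopology y \<zero> sequentially"
    unfolding limit_metric_sequentially
  proof (intro conjI allI impI)
    fix e :: real
    assume "0 < e"
    then have "\<forall>\<^sub>F n in sequentially. vnorm Y (y n) < e"
      using y by (auto simp: null_in_def intro: order_tendstoD(2))
    then obtain N where "\<forall>n\<ge>N. vnorm Y (y n) < e" by (auto simp: eventually_sequentially)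
    then show "\<exists>N. \<forall>n\<ge>N. y n \<in> carrier Y \<and> vdist Y (y n) \<zero> < e"
      using carr by (auto simp: vdist_zero)
  qed simp
  then have K: "compactin mtopology (insert \<zero> (range y))"
    using carr by (intro compactin_sequence_with_limit) auto
  then have "mtopology closure_of range y \<subseteq> insert \<zero> (range y)"
    by (intro closure_of_minimal compactin_imp_closedin[OF Hausdorff_space_mtopology]) auto
  then have "compactin mtopology (mtopology closure_of range y)"
    by (intro closed_compactin[OF K]) auto
  then show ?thesis using carr by (auto simp: relatively_compact_in_def)
qed

lemma relatively_compact_in_imp_bounded:
  assumes "relatively_compact_in Y F"
  obtains B where "0 < B" "\<And>u. u \<in> F \<Longrightarrow> vnorm Y u \<le> B"
proof -
  interpret Metric_space "carrier Y" "vdist Y" by (rule Metric_space_vdist)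
  have F: "F \<subseteq> carrier Y" and "compactin mtopology (mtopology closure_of F)"
    using assms by (auto simp: relatively_compact_in_def Let_def)
  then have "mbounded (mtopology closure_of F)" by (intro compactin_imp_mbounded)
  then have "mbounded F"
    by (rule mbounded_subset) (use F closure_of_subset[of F mtopology] in simp)
  \<comment> \<open>With the origin in the set, a bound on mutual distances bounds norms.\<close>
  then have "mbounded (insert \<zero> F)" by (simp add: mbounded_insert)
  then obtain B where B: "\<And>u. u \<in> F \<Longrightarrow> vdist Y u \<zero> \<le> B"
    unfolding mbounded_alt by auto
  show thesis
  proof (rule that)
    show "0 < \<bar>B\<bar> + 1" by simp
    show "vnorm Y u \<le> \<bar>B\<bar> + 1" if "u \<in> F" for u
      using B[OF that] vdist_zero[of u] F that by force
  qed
qed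

end

text \<open>Weak summability bounds the sections for each single \<open>y\<close>; uniform
  boundedness makes the bound uniform on the unit ball. At \<open>r = \<infinity>\<close> the bound
  is part of the definition.\<close>

lemma (in carrier_banach_space) weakly_summable_bounded:
  assumes r: "1 \<le> r" and a: "weakly_summable (dual Y) r a"
  obtains A where "0 < A" "\<And>y N. y \<in> unit_ball Y \<Longrightarrow> section_norm r N (\<lambda>n. a n y) \<le> A"
proof -
  have dual: "a n \<in> carrier (dual Y)" for n using a by (auto simp: weakly_summable_def)
  have "\<exists>A. \<forall>N. \<forall>y\<in>unit_ball Y. section_norm r N (\<lambda>n. a n y) \<le> A"
  proof (cases "r = \<infinity>")
    case True
    then obtain C where "\<And>n. vnorm (dual Y) (a n) \<le> C" using a by (auto simp: weakly_summable_def)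
    then show ?thesis
      using True
      by (auto simp: section_norm_def intro!: exI[of _ C] intro: order_trans[OF norm_le_dual_norm[OF dual]])
  next
    case False
    have lin: "linear_op (*) Y (a n)" for n using dual[of n] by (simp add: dual_def bounded_op_def)
    obtain A where "\<And>N y. y \<in> unit_ball Y \<Longrightarrow> section_norm r N (\<lambda>n. a n y) \<le> A"
    proof (rule uniform_boundedness[of "\<lambda>N y. section_norm r N (\<lambda>n. a n y)"])
      fix N u v c
      assume u: "u \<in> carrier Y"
      have "a n (c \<odot> u) = c * a n u" for n using lin u by (auto simp: linear_op_def)
      then show "section_norm r N (\<lambda>n. a n (c \<odot> u)) = norm c * section_norm r N (\<lambda>n. a n u)"
        by (simp add: section_norm_mult[OF r])
      show "bdd_above (range (\<lambda>N. section_norm r N (\<lambda>n. a n u)))"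
        using section_norm_le_lp_norm[OF r weakly_summable_apply[OF a False u]] by (rule bdd_aboveI2)
      assume v: "v \<in> carrier Y"
      have "a n (u \<oplus> v) = a n u + a n v" for n using lin u v by (auto simp: linear_op_def)
      then show "section_norm r N (\<lambda>n. a n (u \<oplus> v)) \<le> section_norm r N (\<lambda>n. a n u) + section_norm r N (\<lambda>n. a n v)"
        by (simp add: section_norm_add[OF r])
    next
      fix N
      have "\<forall>n. \<exists>C. \<forall>u\<in>carrier Y. norm (a n u) \<le> C * vnorm Y u"
        using dual by (auto simp: dual_def bounded_op_def)
      from choice[OF this] obtain C where C: "\<And>n u. u \<in> carrier Y \<Longrightarrow> norm (a n u) \<le> C n * vnorm Y u" by blast
      have "section_norm r N (\<lambda>n. a n u) \<le> sum C {..<N} * vnorm Y u" if u: "u \<in> carrier Y" for u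
      proof -
        \<comment> \<open>Valid for finite \<open>r\<close>, where section \<open>N\<close> sees the
          entries below \<open>N\<close>; at \<infinity> it is entry \<open>N\<close>
          itself.\<close>
        have "section_norm r N (\<lambda>n. a n u) = section_norm r N (\<lambda>n. if n < N then a n u else 0)"
          using False by (simp add: section_norm_def)
        also have "\<dots> \<le> (\<Sum>n<N. norm (a n u))" by (rule section_norm_head[OF r])
        also have "\<dots> \<le> (\<Sum>n<N. C n * vnorm Y u)" by (intro sum_mono C u)
        finally show ?thesis by (simp add: sum_distrib_right)
      qed
      then show "\<exists>C. \<forall>u\<in>carrier Y. section_norm r N (\<lambda>n. a n u) \<le> C * vnorm Y u" by blast
    qed blast
    then show ?thesis by blast
  qed
  then obtain A where A: "\<And>N y. y \<in> unit_ball Y \<Longrightarrow> section_norm r N (\<lambda>n. a n y) \<le> A" by blast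
  show thesis
  proof (rule that)
    show "0 < \<bar>A\<bar> + 1" by simp
    show "section_norm r N (\<lambda>n. a n y) \<le> \<bar>A\<bar> + 1" if "y \<in> unit_ball Y" for y N
      using A[OF that, of N] by linarith
  qed
qed

section \<open>Properties of the operators of the two ideals\<close>

context banach_over
begin

text \<open>For \<^term>\<open>r = \<infinity>\<close> the coefficients \<^term>\<open>a n y\<close> are merely bounded; factoring a null sequence
  out of \<^term>\<open>z\<close> turns them into null sequences, as the hull requires.\<close>

lemma nuclear_imp_pr_compact_op:
  assumes pr: "1 \<le> p" "p < \<infinity>" "1 \<le> r" and Y: "carrier_banach_space Y"
    and T: "p1rstar_nuclear_op smul p r Y T"
  shows "pr_compact_op smul p r Y T"
proof -
  interpret Y: carrier_banach_space Y by (rule Y)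
  obtain \<sigma> w a where \<sigma>: "\<sigma> \<in> lp p" and w: "bounded (range w)" and a: "weakly_summable (dual Y) r a"
    and sums: "\<And>y. y \<in> carrier Y \<Longrightarrow> (\<lambda>n. smul (\<sigma> n * a n y) (w n)) sums T y"
    using T by (auto simp: p1rstar_nuclear_op_def)
  obtain A where A: "0 < A" "\<And>y N. y \<in> unit_ball Y \<Longrightarrow> section_norm r N (\<lambda>n. a n y) \<le> A"
    using Y.weakly_summable_bounded[OF pr(3) a] by blast
  obtain B where B: "0 \<le> B" "\<And>n. norm (w n) \<le> B"
    using w by (auto simp: bounded_iff intro: order_trans[OF norm_ge_zero])
  define z where "z n = smul (\<sigma> n) (w n)" for n
  have z_le: "norm (z n) \<le> B * norm (\<sigma> n)" for n
    using mult_right_mono[OF B(2)[of n] norm_ge_zero[of "\<sigma> n"]] by (simp add: z_def norm_smul mult.commute)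
  have "z \<in> lp_ball p (B * lp_norm p \<sigma>)"
  proof (rule lp_ballI[OF pr(1)])
    fix N
    have "section_norm p N z \<le> section_norm p N (\<lambda>n. B * norm (\<sigma> n))"
      using B by (intro section_norm_mono pr(1)) (simp add: z_le abs_mult)
    also have "\<dots> = B * section_norm p N \<sigma>"
      using B by (intro section_norm_scale pr(1)) (auto simp: abs_mult)
    also have "\<dots> \<le> B * lp_norm p \<sigma>"
      using B by (intro mult_left_mono section_norm_le_lp_norm pr(1) \<sigma>) auto
    finally show "section_norm p N z \<le> B * lp_norm p \<sigma>" .
  qed (use pr in auto)
  then have "z \<in> lp p" by (simp add: lp_ball_def)
  then obtain \<tau> v where \<tau>: "\<tau> \<longlonglongrightarrow> 0" and v: "v \<in> lp_ball p 1" and zv: "\<And>k. z k = \<tau> k *\<^sub>R v k"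
    by (rule lp_factor[OF pr(1,2)]) blast
  obtain M where M: "0 < M" "\<And>k. \<bar>\<tau> k\<bar> \<le> M"
    using convergent_imp_Bseq[OF convergentI[OF \<tau>]] by (auto simp: Bseq_def)
  \<comment> \<open>Bounds the weighted coefficients on the unit ball; the factor is then shifted to
    \<open>v\<close> to make them elements of \<open>lp_ball r 1\<close>.\<close>
  define C where "C = M * A"
  have C: "0 < C" using M A by (simp add: C_def)
  have "T y \<in> pr_conv smul r (\<lambda>k. C *\<^sub>R v k)" if y: "y \<in> unit_ball Y" for y
  proof -
    have "(\<lambda>n. smul (a n y) (z n)) sums T y"
      using sums[of y] y by (simp add: unit_ball_def z_def mult.commute)
    then have "(\<lambda>n. smul (of_real (\<tau> n) * a n y) (v n)) sums T y" by (simp add: zv smul_of_real_mult)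
    moreover have "(\<lambda>n. of_real (\<tau> n) * a n y) \<in> lp_ball r C"
      unfolding C_def using A(2)[OF y] \<tau> M(2) by (rule weighted_in_lp_ball[OF pr(3)])
    then have "(\<lambda>n. of_real (inverse C) * (of_real (\<tau> n) * a n y)) \<in> lp_ball r (inverse C * C)"
      using C by (intro lp_ball_scale[OF pr(3), of "inverse C"]) (auto simp: norm_mult norm_inverse)
    moreover have "smul (of_real (inverse C) * c) (C *\<^sub>R u) = smul c u" for c u
      using C by (simp add: smul_of_real_mult del: of_real_inverse)
    ultimately show ?thesis
      using C unfolding pr_conv_def by (intro CollectI bexI[of _ "\<lambda>n. of_real (inverse C) * (of_real (\<tau> n) * a n y)"]) auto
  qed
  moreover have "(\<lambda>k. C *\<^sub>R v k) \<in> lp p"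
    by (rule lp_scale[OF pr(1), of C _ v]) (use v C in \<open>auto simp: lp_ball_def\<close>)
  moreover have "linear_op smul Y T" using T by (simp add: p1rstar_nuclear_op_def bounded_op_def)
  ultimately show ?thesis unfolding pr_compact_op_def rel_pr_compact_def by blast
qed

text \<open>The definition of \<open>pr_compact_op\<close> asks for linearity; continuity follows
  since hulls are bounded by Hoelder's inequality.\<close>

lemma pr_compact_op_imp_bounded_op:
  assumes pr: "1 \<le> p" "p < \<infinity>" "1 \<le> r" "r \<le> conj_index p" and Y: "carrier_normed_space Y"
    and T: "pr_compact_op smul p r Y T"
  shows "bounded_op smul Y T"
proof -
  obtain z where z: "z \<in> lp p" "T ` unit_ball Y \<subseteq> pr_conv smul r z"
    using T by (auto simp: pr_compact_op_def rel_pr_compact_def)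
  have lin: "linear_op smul Y T" using T by (simp add: pr_compact_op_def)
  define C where "C = lp_norm p z + 1"
  have "z \<in> lp_ball p C" "0 < C"
    using z(1) lp_norm_nonneg[OF pr(1) z(1)] by (auto simp: lp_ball_def C_def)
  then have "norm (T u) \<le> 2 * C" if "u \<in> unit_ball Y" for u
    using norm_pr_conv_le[OF pr] z(2) that by blast
  then have "norm (T u) \<le> 2 * C * vnorm Y u" if "u \<in> carrier Y" for u
    using linear_op_le_of_unit_ball[OF Y lin] that by blast
  then show ?thesis using lin unfolding bounded_op_def by blast
qed

lemma ideal_null_imp_null_ideal_compact:
  assumes x: "ideal_null A x"
    and bounded: "\<And>Y T. carrier_banach_space Y \<Longrightarrow> A Y T \<Longrightarrow> bounded_op smul Y T"
  shows "x \<longlonglongrightarrow> 0" and "ideal_compact A (range x)"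
proof -
  obtain Y y T where Y: "carrier_banach_space Y" and y: "null_in Y y" and T: "A Y T" and xT: "\<And>n. x n = T (y n)"
    using x by (auto simp: ideal_null_def)
  interpret Y: carrier_banach_space Y by (rule Y)
  obtain C where "\<And>u. u \<in> carrier Y \<Longrightarrow> norm (T u) \<le> C * vnorm Y u"
    using bounded[OF Y T] by (auto simp: bounded_op_def)
  then have le: "norm (x n) \<le> C * vnorm Y (y n)" for n using y by (auto simp: null_in_def xT)
  have "(\<lambda>n. C * vnorm Y (y n)) \<longlonglongrightarrow> 0"
    using y by (auto simp: null_in_def intro: tendsto_mult_right_zero)
  then show "x \<longlonglongrightarrow> 0"
    by (rule Lim_null_comparison[rotated]) (simp add: le)
  show "ideal_compact A (range x)"
    unfolding ideal_compact_def using Y T Y.null_in_imp_relatively_compact_in[OF y] xT by blast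
qed

text \<open>A relatively compact set lies in a multiple of the unit ball, and the factor can be
  absorbed by the generating sequence.\<close>

lemma ideal_compact_imp_rel_pr_compact:
  assumes p: "1 \<le> p" and K: "ideal_compact (pr_compact_op smul p r :: ('k, 'y, 'x) op_ideal) K"
  shows "rel_pr_compact smul p r K"
proof -
  obtain Y :: "('k, 'y) nspace" and F T where Y: "carrier_banach_space Y" and F: "relatively_compact_in Y F"
    and T: "pr_compact_op smul p r Y T" and K: "K \<subseteq> T ` F"
    using K by (auto simp: ideal_compact_def)
  interpret Y: carrier_banach_space Y by (rule Y)
  obtain z where z: "z \<in> lp p" "\<And>u. u \<in> unit_ball Y \<Longrightarrow> T u \<in> pr_conv smul r z"
    using T by (auto simp: pr_compact_op_def rel_pr_compact_def)
  obtain B where B: "0 < B" "\<And>u. u \<in> F \<Longrightarrow> vnorm Y u \<le> B"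
    using Y.relatively_compact_in_imp_bounded[OF F] by blast
  have "T u \<in> pr_conv smul r (\<lambda>k. B *\<^sub>R z k)" if u: "u \<in> F" for u
  proof -
    have "u \<in> carrier Y" using F u by (auto simp: relatively_compact_in_def)
    then obtain v where v: "v \<in> unit_ball Y" "u = of_real B \<odot>\<^bsub>Y\<^esub> v"
      using Y.unit_ball_scale[OF _ B(2)[OF u] B(1)] by blast
    have "v \<in> carrier Y" using v(1) by (simp add: unit_ball_def)
    then have "T u = B *\<^sub>R T v"
      using T unfolding v(2) smul_of_real[symmetric] pr_compact_op_def linear_op_def by blast
    then show ?thesis using pr_conv_scaleR[OF z(2)[OF v(1)]] by simp
  qed
  moreover have "(\<lambda>k. B *\<^sub>R z k) \<in> lp p"
    by (rule lp_scale[OF p, of B _ z]) (use B(1) z(1) in auto)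
  ultimately show ?thesis using K unfolding rel_pr_compact_def by blast
qed

end

section \<open>Null sequences as images under nuclear operators\<close>

text \<open>The quotient stands for u to the power q - 1, in the form in which the test coefficients
  below produce it. Replacing the smaller of u and v by the larger gives one of the two
  terms.\<close>

lemma powr_divide_mult_le:
  fixes u v q :: real
  assumes "0 \<le> u" "0 \<le> v" "1 \<le> q"
  shows "u powr q / u * v \<le> u powr q + v powr q"
proof (cases "u = 0")
  case False
  then have u: "0 < u" using assms by simp
  show ?thesis
  proof (cases "v \<le> u")
    case True
    then have "v / u \<le> 1" using u by simp
    then have "u powr q * (v / u) \<le> u powr q * 1" by (intro mult_left_mono) auto
    then show ?thesis by (simp add: add_increasing2)
  next
    case False
    then have v: "0 < v" "u < v" using u by auto
    have "u powr q / u * v = u powr (q - 1) * v" using u by (simp add: powr_diff)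
    also have "\<dots> \<le> v powr (q - 1) * v"
      using u v assms by (intro mult_right_mono powr_mono2) auto
    also have "\<dots> = v powr q" using v by (simp add: powr_diff)
    finally show ?thesis by (simp add: add_increasing)
  qed
qed simp

context embedded_section_space
begin

definition coord :: "nat \<Rightarrow> 'y \<Rightarrow> 'k" where
  "coord n u = (if u \<in> carrier Y then inv_into UNIV \<iota> u n else 0)"

lemma coord_\<iota> [simp]: "bdd a \<Longrightarrow> coord n (\<iota> a) = a n"
  by (simp add: coord_def)

lemma norm_coord_le: "u \<in> carrier Y \<Longrightarrow> norm (coord n u) \<le> vnorm Y u"
  by (auto elim!: carrierE intro!: norm_le_section_norm[OF r] section_norm_le_vnorm)

lemma linear_coord: "linear_op (*) Y (coord n)"
  by (auto simp: linear_op_def bdd_add bdd_mult elim!: carrierE)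

lemma sum_coord_in_dual: "(\<lambda>u. \<Sum>n\<in>I. t n * coord n u) \<in> carrier (dual Y)"
proof -
  have "linear_op (*) Y (\<lambda>u. \<Sum>n\<in>I. t n * coord n u)"
    using linear_coord
    by (simp add: linear_op_def distrib_left sum.distrib sum_distrib_left mult.left_commute)
  moreover have "norm (\<Sum>n\<in>I. t n * coord n u) \<le> (\<Sum>n\<in>I. norm (t n)) * vnorm Y u" if "u \<in> carrier Y" for u
    unfolding sum_distrib_right using that
    by (intro sum_norm_le) (auto simp: norm_mult intro!: mult_left_mono norm_coord_le)
  moreover have "(\<Sum>n\<in>I. t n * coord n u) = 0" if "u \<notin> carrier Y" for u
    using that by (simp add: coord_def)
  ultimately show ?thesis unfolding dual_def bounded_op_def by auto
qed

lemma coord_in_dual: "coord n \<in> carrier (dual Y)"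
  using sum_coord_in_dual[where I = "{n}" and t = "\<lambda>_. 1"] by (simp add: fun_eq_iff)

lemma bidual_sum_coord:
  assumes \<phi>: "\<phi> \<in> carrier (dual (dual Y))" and "finite I"
  shows "\<phi> (\<lambda>u. \<Sum>n\<in>I. t n * coord n u) = (\<Sum>n\<in>I. t n * \<phi> (coord n))"
  using \<open>finite I\<close>
proof induction
  case empty
  have "\<phi> (smult (dual Y) 0 (coord 0)) = 0 * \<phi> (coord 0)"
    using \<phi> coord_in_dual unfolding dual_def[of "dual Y"] bounded_op_def linear_op_def by simp
  then show ?case by (simp add: dual_def)
next
  case (insert i I)
  let ?f = "\<lambda>u. \<Sum>n\<in>I. t n * coord n u"
  have ti: "(\<lambda>u. t i * coord i u) \<in> carrier (dual Y)"
    using sum_coord_in_dual[of t "{i}"] by simp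
  have "\<phi> (add (dual Y) (\<lambda>u. t i * coord i u) ?f) = \<phi> (\<lambda>u. t i * coord i u) + \<phi> ?f"
    using \<phi> ti sum_coord_in_dual[of t I] unfolding dual_def[of "dual Y"] bounded_op_def linear_op_def by simp
  moreover have "\<phi> (smult (dual Y) (t i) (coord i)) = t i * \<phi> (coord i)"
    using \<phi> coord_in_dual unfolding dual_def[of "dual Y"] bounded_op_def linear_op_def by simp
  ultimately show ?case using insert by (simp add: dual_def)
qed

text \<open>The functional is tested on the combination of the coordinates whose coefficients are, up to
  normalisation, those of the equality case of Hoelder's inequality.\<close>

lemma section_norm_bidual_coord_le:
  assumes \<phi>: "\<phi> \<in> carrier (dual (dual Y))" and "r \<noteq> \<infinity>"
    and C: "0 \<le> C" "\<And>f. f \<in> carrier (dual Y) \<Longrightarrow> norm (\<phi> f) \<le> C * vnorm (dual Y) f"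
  shows "section_norm r N (\<lambda>n. \<phi> (coord n)) \<le> 2 * C"
proof -
  define q where "q = real_of_ereal r"
  have q: "1 \<le> q" using r \<open>r \<noteq> \<infinity>\<close> by (simp add: q_def real_of_ereal_ge_1)
  define \<sigma> where "\<sigma> = section_norm r N (\<lambda>n. \<phi> (coord n))"
  have \<sigma>q: "\<sigma> powr q = (\<Sum>n<N. norm (\<phi> (coord n)) powr q)"
    using \<open>r \<noteq> \<infinity>\<close> q by (simp add: \<sigma>_def section_norm_def q_def[symmetric] powr_powr sum_nonneg)
  show ?thesis
  proof (cases "\<sigma> = 0")
    case True
    then show ?thesis using C(1) by (simp add: \<sigma>_def)
  next
    case False
    then have \<sigma>: "0 < \<sigma>" by (simp add: \<sigma>_def less_le)
    define u where "u n = norm (\<phi> (coord n)) / \<sigma>" for n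
    have u: "0 \<le> u n" for n using \<sigma> by (simp add: u_def)
    have u1: "(\<Sum>n<N. u n powr q) = 1"
      using \<sigma> by (simp add: u_def powr_divide sum_divide_distrib[symmetric] flip: \<sigma>q)
    \<comment> \<open>Chosen so that \<open>t n * \<phi> (coord n)\<close> is
      \<open>u n powr q\<close>, with sum 1. Where \<open>\<phi> (coord n)\<close> vanishes, both
      sides are 0 by the default value of division.\<close>
    define t where "t n = of_real (u n powr q) / \<phi> (coord n)" for n
    have norm_t: "norm (t n) = u n powr q / u n / \<sigma>" for n
      using \<sigma> u[of n] by (simp add: t_def norm_divide u_def)
    let ?f = "\<lambda>y. \<Sum>n<N. t n * coord n y"
    have "t n * \<phi> (coord n) = of_real (u n powr q)" for n by (simp add: t_def u_def)
    then have \<phi>f: "\<phi> ?f = 1" using u1 by (simp add: bidual_sum_coord[OF \<phi>] flip: of_real_sum)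
    \<comment> \<open>Both the powers of \<open>u\<close> and those of the entries of a point of the
      unit ball sum to at most 1. As \<open>\<phi>\<close> has value 1 at this functional, the bound
      gives \<sigma> \<le> 2 C.\<close>
    have "vnorm (dual Y) ?f \<le> 2 / \<sigma>"
    proof (rule dual_norm_le)
      fix y
      assume "y \<in> unit_ball Y"
      then obtain a where a: "y = \<iota> a" "bdd a" "vnorm Y y \<le> 1"
        by (auto simp: unit_ball_def elim!: carrierE)
      then have "section_norm r N a \<le> 1" using section_norm_le_vnorm[OF a(2), of N] by simp
      then have a1: "(\<Sum>n<N. norm (a n) powr q) \<le> 1"
        using sum_powr_section_norm_le_1[OF r \<open>r \<noteq> \<infinity>\<close>, of 1 N a] by (simp add: q_def)
      have "norm (?f y) \<le> (\<Sum>n<N. (u n powr q + norm (a n) powr q) / \<sigma>)"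
      proof (rule sum_norm_le)
        fix n
        have "norm (t n * coord n y) = u n powr q / u n * norm (a n) / \<sigma>"
          using a by (simp add: norm_mult norm_t)
        also have "\<dots> \<le> (u n powr q + norm (a n) powr q) / \<sigma>"
          using \<sigma> q u by (intro divide_right_mono powr_divide_mult_le) auto
        finally show "norm (t n * coord n y) \<le> (u n powr q + norm (a n) powr q) / \<sigma>" .
      qed
      also have "\<dots> = (1 + (\<Sum>n<N. norm (a n) powr q)) / \<sigma>"
        by (simp add: u1 sum.distrib flip: sum_divide_distrib)
      also have "\<dots> \<le> 2 / \<sigma>" using a1 \<sigma> by (intro divide_right_mono) auto
      finally show "norm (?f y) \<le> 2 / \<sigma>" .
    qed
    then have "C * vnorm (dual Y) ?f \<le> C * (2 / \<sigma>)" using C(1) by (rule mult_left_mono)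
    then have "1 \<le> C * (2 / \<sigma>)" using C(2)[OF sum_coord_in_dual[of t "{..<N}"]] \<phi>f by simp
    then show ?thesis using \<sigma> by (simp add: field_simps flip: \<sigma>_def)
  qed
qed

text \<open>For finite \<open>r\<close> all functionals of the bidual have to be tested, not just
  evaluations, for which the claim would be the definition of the carrier.\<close>

lemma weakly_summable_coord: "weakly_summable (dual Y) r coord"
proof (cases "r = \<infinity>")
  case True
  have "vnorm (dual Y) (coord n) \<le> 1" for n
    using norm_coord_le by (intro dual_norm_le) (auto simp: unit_ball_def intro: order_trans)
  then show ?thesis using True coord_in_dual by (auto simp: weakly_summable_def)
next
  case False
  have "(\<lambda>n. \<phi> (coord n)) \<in> lp r" if \<phi>: "\<phi> \<in> carrier (dual (dual Y))" for \<phi>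
  proof -
    obtain C where C: "\<And>f. f \<in> carrier (dual Y) \<Longrightarrow> norm (\<phi> f) \<le> C * vnorm (dual Y) f"
      using \<phi> unfolding dual_def[of "dual Y"] bounded_op_def by auto
    have "norm (\<phi> f) \<le> \<bar>C\<bar> * vnorm (dual Y) f" if "f \<in> carrier (dual Y)" for f
      using C[OF that] mult_right_mono[OF abs_ge_self[of C] dual_norm_nonneg[OF that]] by linarith
    then have "(\<lambda>n. \<phi> (coord n)) \<in> lp_ball r (2 * \<bar>C\<bar>)"
      using False by (intro lp_ballI[OF r] section_norm_bidual_coord_le[OF \<phi> False]) auto
    then show ?thesis by (simp add: lp_ball_def)
  qed
  then show ?thesis using False coord_in_dual by (auto simp: weakly_summable_def)
qed

end

text \<open>The operator sums a coefficient sequence against \<open>w\<close>, so it maps the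
  embedded \<open>b n\<close> to \<open>x n\<close>; section norms are at most
  \<open>lp_norm\<close>, hence the preimages are null.\<close>

lemma (in banach_over) coefficients_imp_ideal_null:
  fixes \<iota> :: "(nat \<Rightarrow> 'k) \<Rightarrow> 'y"
  assumes pr: "1 \<le> p" "p < \<infinity>" "1 \<le> r" "r \<le> conj_index p" and \<iota>: "inj \<iota>"
    and w: "w \<in> lp_ball p 1" and b: "\<And>n. b n \<in> lp r" "\<And>n. (\<lambda>k. smul (b n k) (w k)) sums x n"
    and null: "(\<lambda>n. lp_norm r (b n)) \<longlonglongrightarrow> 0"
  shows "ideal_null (p1rstar_nuclear_op smul p r :: ('k, 'y, 'x) op_ideal) x"
proof -
  interpret embedded_section_space \<iota> r using \<iota> pr(3) by unfold_locales
  define T where "T u = (\<Sum>k. smul (coord k u) (w k))" for u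
  have ball: "section_norm r N (\<lambda>k. coord k u) \<le> vnorm Y u" if "u \<in> carrier Y" for u N
    using that by (auto elim!: carrierE intro: section_norm_le_vnorm)
  have sums: "(\<lambda>k. smul (coord k u) (w k)) sums T u" if u: "u \<in> carrier Y" for u
    unfolding T_def
  proof (intro summable_sums norm_sums_le(1)[OF pr])
    show "0 < vnorm Y u + 1" using vnorm_nonneg[OF u] by simp
    show "section_norm r N (\<lambda>k. coord k u) \<le> vnorm Y u + 1" for N using ball[OF u, of N] by simp
  qed (use w in auto)
  have "linear_op smul Y T"
    unfolding linear_op_def
  proof (intro conjI ballI allI)
    fix u v c
    assume u: "u \<in> carrier Y"
    have "(\<lambda>k. smul c (smul (coord k u) (w k))) sums smul c (T u)"
    proof (rule bounded_linear.sums[OF _ sums[OF u]])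
      show "bounded_linear (smul c)"
        by (rule bounded_linear_intro[of _ "norm c"])
          (auto simp: scale_right_distrib smul_scaleR norm_smul mult.commute)
    qed
    then have "(\<lambda>k. smul (coord k (c \<odot>\<^bsub>Y\<^esub> u)) (w k)) sums smul c (T u)"
      using linear_coord u by (simp add: linear_op_def)
    then show "T (c \<odot>\<^bsub>Y\<^esub> u) = smul c (T u)" using sums_unique by (fastforce simp: T_def)
    assume v: "v \<in> carrier Y"
    have "(\<lambda>k. smul (coord k (u \<oplus>\<^bsub>Y\<^esub> v)) (w k)) sums (T u + T v)"
      using sums_add[OF sums[OF u] sums[OF v]] linear_coord u v by (simp add: linear_op_def scale_left_distrib)
    then show "T (u \<oplus>\<^bsub>Y\<^esub> v) = T u + T v" using sums_unique by (fastforce simp: T_def)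
  qed
  moreover have "norm (T u) \<le> 2" if "u \<in> unit_ball Y" for u
  proof -
    have "section_norm r N (\<lambda>k. coord k u) \<le> 1" for N
      using ball[of u N] that by (simp add: unit_ball_def)
    then show ?thesis
      using norm_sums_le(2)[OF pr, of 1 "\<lambda>k. coord k u" 1 w] w by (simp add: T_def)
  qed
  ultimately have T: "bounded_op smul Y T"
    unfolding bounded_op_def using linear_op_le_of_unit_ball[OF carrier_normed_space] by blast
  have "p1rstar_nuclear_op smul p r Y T"
    unfolding p1rstar_nuclear_op_def
  proof (intro conjI T bexI exI ballI)
    \<comment> \<open>For the nuclear form \<open>w n\<close> is split into its norm, which carries
      the summability, and a bounded direction, which is 0 by default when
      \<open>w n = 0\<close>.\<close>
    show "(\<lambda>n. of_real (norm (w n)) :: 'k) \<in> lp p"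
      by (rule lp_scale[OF pr(1), of 1 _ w]) (use w in \<open>auto simp: lp_ball_def\<close>)
    show "bounded (range (\<lambda>n. w n /\<^sub>R norm (w n)))"
    proof (rule boundedI, safe)
      show "norm (w n /\<^sub>R norm (w n)) \<le> 1" for n by (cases "w n = 0") simp_all
    qed
    show "(\<lambda>n. smul (of_real (norm (w n)) * coord n y) (w n /\<^sub>R norm (w n))) sums T y" if "y \<in> carrier Y" for y
    proof -
      have "smul (of_real (norm (w n)) * coord n y) (w n /\<^sub>R norm (w n)) = smul (coord n y) (w n)" for n
        by (cases "w n = 0") (simp_all add: smul_of_real_mult)
      then show ?thesis using sums[OF that] by simp
    qed
  qed (rule weakly_summable_coord)
  moreover have bdd_b: "bdd (b n)" for n
    using section_norm_le_lp_norm[OF pr(3) b(1)] by (rule bddI)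
  moreover have "null_in Y (\<lambda>n. \<iota> (b n))"
  proof -
    have "(\<lambda>n. vnorm Y (\<iota> (b n))) \<longlonglongrightarrow> 0"
    proof (rule tendsto_sandwich[OF _ _ tendsto_const null])
      show "\<forall>\<^sub>F n in sequentially. 0 \<le> vnorm Y (\<iota> (b n))"
        using bdd_b by (simp add: vnorm_nonneg)
      show "\<forall>\<^sub>F n in sequentially. vnorm Y (\<iota> (b n)) \<le> lp_norm r (b n)"
        using section_norm_le_lp_norm[OF pr(3) b(1)] by (intro always_eventually allI vnorm_le)
    qed
    then show ?thesis using bdd_b by (auto simp: null_in_def)
  qed
  moreover have "x n = T (\<iota> (b n))" for n
    using sums_unique[OF b(2)[of n]] bdd_b by (simp add: T_def)
  ultimately show ?thesis unfolding ideal_null_def using carrier_banach_space by blast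
qed

section \<open>The equivalences\<close>

text \<open>The implications form cycles through (b): b to g to a to b, and b to e, then through c
  or f to d and back to b. The hypothesis \<open>universe\<close> makes room for the sequence space
  on which the nuclear operator in (e) is built; this space depends on \<open>r\<close> and the
  embedding but not on \<open>x\<close>.\<close>

theorem theorem3p1:
  fixes smul :: "'k::{real_normed_field,euclidean_space} \<Rightarrow> 'x::banach \<Rightarrow> 'x"
    and p r :: ereal and x :: "nat \<Rightarrow> 'x"
  assumes "banach_over smul"
    and "1 \<le> p" and "p < \<infinity>" and "1 \<le> r" and "r \<le> conj_index p"
    and universe: "\<exists>\<iota> :: (nat \<Rightarrow> 'k) \<Rightarrow> 'y. inj \<iota>"
  shows
    "let \<N> = (p1rstar_nuclear_op smul p r :: ('k, 'y, 'x) op_ideal);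
         \<K> = (pr_compact_op smul p r :: ('k, 'y, 'x) op_ideal);
         a = pr_null smul p r x;
         b = (x \<longlonglongrightarrow> 0 \<and> rel_pr_compact smul p r (range x));
         c = (x \<longlonglongrightarrow> 0 \<and> ideal_compact \<N> (range x));
         d = (x \<longlonglongrightarrow> 0 \<and> ideal_compact \<K> (range x));
         e = ideal_null \<N> x;
         f = ideal_null \<K> x;
         g = uniformly_pr_null smul p r x
     in (a \<longleftrightarrow> b) \<and> (a \<longleftrightarrow> c) \<and> (a \<longleftrightarrow> d) \<and> (a \<longleftrightarrow> e) \<and> (a \<longleftrightarrow> f) \<and> (a \<longleftrightarrow> g)"
proof -
  interpret banach_over smul by fact
  note pr = assms(2-5)
  obtain \<iota> :: "(nat \<Rightarrow> 'k) \<Rightarrow> 'y" where \<iota>: "inj \<iota>" using universe by blast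
  let ?N = "p1rstar_nuclear_op smul p r :: ('k, 'y, 'x) op_ideal"
  let ?K = "pr_compact_op smul p r :: ('k, 'y, 'x) op_ideal"
  let ?a = "pr_null smul p r x"
  let ?b = "x \<longlonglongrightarrow> 0 \<and> rel_pr_compact smul p r (range x)"
  let ?c = "x \<longlonglongrightarrow> 0 \<and> ideal_compact ?N (range x)"
  let ?d = "x \<longlonglongrightarrow> 0 \<and> ideal_compact ?K (range x)"
  let ?e = "ideal_null ?N x"
  let ?f = "ideal_null ?K x"
  let ?g = "uniformly_pr_null smul p r x"
  have "?g \<and> ?e" if b: ?b
  proof -
    obtain w b where "w \<in> lp_ball p 1" "\<And>n. b n \<in> lp r" "\<And>n. (\<lambda>k. smul (b n k) (w k)) sums x n"
      "(\<lambda>n. lp_norm r (b n)) \<longlonglongrightarrow> 0"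
      using null_rel_pr_compact_coefficients[OF pr] b by blast
    then show ?thesis
      using coefficients_imp_uniformly_pr_null[OF pr(3)] coefficients_imp_ideal_null[OF pr \<iota>] by blast
  qed
  then have bg: "?b \<Longrightarrow> ?g" and be: "?b \<Longrightarrow> ?e" by blast+
  have ga: "?g \<Longrightarrow> ?a" by (rule uniformly_pr_null_imp_pr_null[OF pr(1)])
  have ab: "?a \<Longrightarrow> ?b" using pr_null_imp_null_rel_pr_compact[OF pr] by blast
  have NK: "?K Y T" if "carrier_banach_space Y" "?N Y T" for Y T
    using nuclear_imp_pr_compact_op[OF pr(1-3) that] .
  have ef: "?e \<Longrightarrow> ?f" unfolding ideal_null_def using NK by blast
  have cd: "?c \<Longrightarrow> ?d" unfolding ideal_compact_def using NK by blast
  have ec: "?e \<Longrightarrow> ?c"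
    using ideal_null_imp_null_ideal_compact[of ?N x] unfolding p1rstar_nuclear_op_def by blast
  have "bounded_op smul Y T" if "carrier_banach_space Y" "?K Y T" for Y T
    using pr_compact_op_imp_bounded_op[OF pr carrier_banach_space.axioms(1)[OF that(1)] that(2)] .
  then have fd: "?f \<Longrightarrow> ?d" using ideal_null_imp_null_ideal_compact[of ?K x] by blast
  have db: "?d \<Longrightarrow> ?b" using ideal_compact_imp_rel_pr_compact[OF pr(1)] by blast
  show ?thesis unfolding Let_def using bg be ga ab ef cd ec fd db by argo
qed

end
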